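(* Let $p\geq 14000$ be a prime and let $A\subseteq\mathbb{Z}/p\mathbb{Z}$ be sum-free with $|A|\geq 0.313\,p$. Then there exists $m\in[1,p-1]$ such that $m\cdot A\subseteq [\,|A|,\,p-|A|\,]$, where $\mathbb{Z}/p\mathbb{Z}$ is identified with the integers $\{0,1,\dots,p-1\}$.
   Context: A set $A\subseteq\mathbb{Z}/p\mathbb{Z}$ is sum-free if there are no $x,y,z\in A$ with $x+y=z$. For an integer $m$, $m\cdot A=\{mx:x\in A\}$. The interval $[\,|A|,p-|A|\,]$ denotes the set of residues of the integers $|A|,|A|+1,\dots,p-|A|$. *)

theory Defs
  imports Complex_Main "HOL-Computational_Algebra.Primes"
begin

text \<open>Z/pZ is identified with {0..<p} (nat). A set A of residues is sum-free
  if there are no x,y,z in A with x + y = z (mod p).\<close>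

definition sum_free_mod :: "nat \<Rightarrow> nat set \<Rightarrow> bool" where
  "sum_free_mod p A \<longleftrightarrow> (\<forall>x\<in>A. \<forall>y\<in>A. \<forall>z\<in>A. (x + y) mod p \<noteq> z)"

definition dilate_mod :: "nat \<Rightarrow> nat \<Rightarrow> nat set \<Rightarrow> nat set" where
  "dilate_mod p m A = (\<lambda>x. (m * x) mod p) ` A"

end

theory Submission
  imports Defs "HOL-Library.Set_Algebras" "HOL-Number_Theory.Cong"
begin

text \<open>
  Orthogonality and $A \cap (A + A) = \emptyset$ give a dilate \<open>B\<close> of \<open>A\<close>, with $n = |A|$, for which
  $\sum_{b \in B} \cos(2\pi b/p) \le -n^2/(p-n)$. A set whose points are spread so evenly that every half circle
  contains fewer than \<open>(p - n + 7)/3\<close> of them cannot have such a large cosine sum, so some half circle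
  contains a part $B_1$ of \<open>B\<close> with $|B_1| = k \ge (p-n+7)/3$.

  Differences of $B_1$ are the same as integers and modulo \<open>p\<close>, and they avoid \<open>B\<close>, so $|B_1 - B_1| \le p - n
  \le 3k - 7$. In the integers this forces $B_1 - B_1$ to contain \<open>g * e\<close> for some \<open>g > 0\<close> and all $|e| < k$
  (the long progression in the \<open>3k - 4\<close> theorem). Since \<open>B\<close> avoids these, $g^{-1} B$ lies in
  \<open>{k..p - k}\<close>. This confines the set to an arc only slightly longer than a half circle, whence a half circle
  contains more than \<open>n/3 + p/6\<close> of its points; a second pass confines it to a half circle, and a
  third pass, with \<open>k = n\<close>, gives the theorem.
\<close>

section \<open>Periodic sets of integers\<close>

text \<open>Integer methods apply only to the part of the set inside a half circle, while the
  differences of that part avoid the whole set. So a pass needs \<open>k \<ge> (p - n + 7)/3\<close>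
  points in a half circle and clears an interval of radius \<open>k\<close> only; radius
  \<open>n\<close> requires the whole set to lie in a half circle. The first pass guarantees only an
  arc of length about \<open>(p + 2 n)/3\<close>, which exceeds \<open>p/2\<close>, whence the
  intermediate one. The density 0.313 is dictated by the cosine sum. For \<open>n = c p\<close>, a
  set with few points in each half circle has a negative sum of size at most about
  \<open>p sin(pi (2 - 5 c)/3) / pi\<close>, while sum-freeness forces
  \<open>c^2 p / (1 - c)\<close>. These are 0.1400 p and 0.1426 p at c = 0.313, but the order is
  already reversed at c = 0.312. The bound 14000 absorbs the additive rounding errors.\<close>

text \<open>A subset of $\mathbb{Z}/n\mathbb{Z}$ is represented by its preimage, an \<open>n\<close>-periodic set of integers;
  its cardinality is then \<open>period_card n\<close>, and subgroups are the sets \<open>{x. h dvd x}\<close> with \<open>h dvd n\<close>.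
  This allows the modulus to be a term rather than a type.\<close>

definition periodic :: "int \<Rightarrow> int set \<Rightarrow> bool" where
  "periodic n P \<longleftrightarrow> (\<forall>x y. n dvd x - y \<longrightarrow> x \<in> P \<longrightarrow> y \<in> P)"

definition period_card :: "int \<Rightarrow> int set \<Rightarrow> nat" where
  "period_card n P = card (P \<inter> {0..<n})"

lemma periodicD: "periodic n P \<Longrightarrow> n dvd x - y \<Longrightarrow> x \<in> P \<Longrightarrow> y \<in> P"
  unfolding periodic_def by blast

lemma periodic_mod_iff: "periodic n P \<Longrightarrow> x mod n \<in> P \<longleftrightarrow> x \<in> P"
  by (meson periodicD dvd_minus_mod mod_eq_dvd_iff mod_mod_trivial)

lemma periodic_Compl: "periodic n P \<Longrightarrow> periodic n (- P)"
  unfolding periodic_def by (metis ComplD ComplI dvd_diff_commute)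

lemma periodic_Int: "periodic n P \<Longrightarrow> periodic n Q \<Longrightarrow> periodic n (P \<inter> Q)"
  unfolding periodic_def by blast

lemma periodic_Un: "periodic n P \<Longrightarrow> periodic n Q \<Longrightarrow> periodic n (P \<union> Q)"
  unfolding periodic_def by blast

lemma periodic_plus: "periodic n P \<Longrightarrow> periodic n (P + Q)" for Q :: "int set"
proof -
  assume P: "periodic n P"
  have "y \<in> P + Q" if "n dvd x - y" "x \<in> P + Q" for x y
  proof -
    obtain a b where ab: "a \<in> P" "b \<in> Q" "x = a + b" using \<open>x \<in> P + Q\<close> by (auto elim: set_plus_elim)
    have "n dvd a - (y - b)" using that ab by (simp add: algebra_simps)
    then have "y - b \<in> P" using P ab periodicD by blast
    then have "(y - b) + b \<in> P + Q" using ab by (intro set_plus_intro)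
    then show ?thesis by simp
  qed
  then show ?thesis unfolding periodic_def by blast
qed

lemma periodic_uminus: "periodic n P \<Longrightarrow> periodic n (uminus ` P)"
  unfolding periodic_def
proof (intro allI impI)
  fix x y assume *: "\<forall>x y. n dvd x - y \<longrightarrow> x \<in> P \<longrightarrow> y \<in> P" "n dvd x - y" "x \<in> uminus ` P"
  have "-x \<in> P" using * by auto
  moreover have "n dvd (-x) - (-y)" using *(2) by (metis dvd_diff_commute minus_diff_commute minus_diff_eq uminus_add_conv_diff diff_minus_eq_add)
  ultimately have "- y \<in> P" using * by blast
  then show "y \<in> uminus ` P" by force
qed

lemma period_card_le: "period_card n P \<le> nat n"
  unfolding period_card_def using card_mono[of "{0..<n}" "P \<inter> {0..<n}"] by auto

lemma period_card_mono: "P \<subseteq> Q \<Longrightarrow> period_card n P \<le> period_card n Q"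
  unfolding period_card_def by (intro card_mono) auto

lemma period_card_UNIV: "period_card n UNIV = nat n"
  unfolding period_card_def by simp

lemma period_card_Compl: "period_card n (- P) + period_card n P = nat n"
proof -
  have "card ((- P \<inter> {0..<n}) \<union> (P \<inter> {0..<n})) = period_card n (- P) + period_card n P"
    unfolding period_card_def by (intro card_Un_disjoint) auto
  moreover have "(- P \<inter> {0..<n}) \<union> (P \<inter> {0..<n}) = {0..<n}" by auto
  ultimately show ?thesis by simp
qed

lemma period_card_Un_Int: "period_card n (P \<union> Q) + period_card n (P \<inter> Q) = period_card n P + period_card n Q"
proof -
  have "period_card n P + period_card n Q = card ((P \<inter> {0..<n}) \<union> (Q \<inter> {0..<n})) + card ((P \<inter> {0..<n}) \<inter> (Q \<inter> {0..<n}))"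
    unfolding period_card_def by (intro card_Un_Int) auto
  moreover have "(P \<inter> {0..<n}) \<union> (Q \<inter> {0..<n}) = (P \<union> Q) \<inter> {0..<n}"
    "(P \<inter> {0..<n}) \<inter> (Q \<inter> {0..<n}) = (P \<inter> Q) \<inter> {0..<n}" by auto
  ultimately show ?thesis unfolding period_card_def by simp
qed

lemma period_card_pos: "0 < n \<Longrightarrow> periodic n P \<Longrightarrow> P \<noteq> {} \<Longrightarrow> 0 < period_card n P"
proof -
  assume n: "0 < n" and P: "periodic n P" "P \<noteq> {}"
  then obtain x where "x \<in> P" by blast
  then have "x mod n \<in> P \<inter> {0..<n}" using P n periodic_mod_iff by auto
  then show ?thesis unfolding period_card_def by (metis card_gt_0_iff empty_iff finite_Int finite_atLeastLessThan_int)
qed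

lemma periodic_subset_period_card_eq:
  assumes n: "0 < n" and P: "periodic n P" and Q: "periodic n Q" and "P \<subseteq> Q" "period_card n P \<ge> period_card n Q"
  shows "P = Q"
proof -
  have "P \<inter> {0..<n} = Q \<inter> {0..<n}"
    using assms(4,5) unfolding period_card_def by (intro card_seteq) auto
  then have "x \<in> P" if "x \<in> Q" for x
  proof -
    have "x mod n \<in> Q \<inter> {0..<n}" using that Q n periodic_mod_iff by auto
    then have "x mod n \<in> P" using \<open>P \<inter> {0..<n} = Q \<inter> {0..<n}\<close> by blast
    then show ?thesis using P periodic_mod_iff by blast
  qed
  then show ?thesis using assms(4) by blast
qed

lemma period_card_affine:
  assumes n: "0 < n" and P: "periodic n P" and u: "u = 1 \<or> u = (-1::int)"
  shows "period_card n ((\<lambda>x. u * x + t) ` P) = period_card n P"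
proof -
  have uu: "u * u = 1" using u by auto
  have inv: "(u * ((u * x + t) mod n - t)) mod n = x mod n" for x
  proof -
    have "(u * ((u * x + t) mod n - t)) mod n = (u * ((u * x + t) - t)) mod n"
      by (metis mod_diff_left_eq mod_mult_right_eq)
    also have "u * ((u * x + t) - t) = (u * u) * x" by (simp add: algebra_simps)
    finally show ?thesis using uu by simp
  qed
  have inv2: "(u * ((u * (y - t)) mod n) + t) mod n = y mod n" for y
  proof -
    have "(u * ((u * (y - t)) mod n) + t) mod n = (u * (u * (y - t)) + t) mod n"
      by (metis mod_add_left_eq mod_mult_right_eq)
    also have "u * (u * (y - t)) + t = (u * u) * (y - t) + t" by (simp add: algebra_simps)
    finally show ?thesis using uu by simp
  qed
  have "bij_betw (\<lambda>x. (u * x + t) mod n) (P \<inter> {0..<n}) ((\<lambda>x. u * x + t) ` P \<inter> {0..<n})"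
  proof (rule bij_betw_byWitness[where f' = "\<lambda>y. (u * (y - t)) mod n"])
    show "\<forall>a\<in>P \<inter> {0..<n}. u * ((u * a + t) mod n - t) mod n = a" using inv by auto
    show "\<forall>a'\<in>(\<lambda>x. u * x + t) ` P \<inter> {0..<n}. (u * (u * (a' - t) mod n) + t) mod n = a'" using inv2 by auto
    show "(\<lambda>x. (u * x + t) mod n) ` (P \<inter> {0..<n}) \<subseteq> (\<lambda>x. u * x + t) ` P \<inter> {0..<n}"
    proof
      fix z assume "z \<in> (\<lambda>x. (u * x + t) mod n) ` (P \<inter> {0..<n})"
      then obtain x where x: "x \<in> P" "z = (u * x + t) mod n" by auto
      have "x mod n = (u * (z - t)) mod n" using inv x by simp
      then have "u * (z - t) \<in> P" using x P periodic_mod_iff by metis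
      then have "u * (u * (z - t)) + t \<in> (\<lambda>x. u * x + t) ` P" by blast
      moreover have "u * (u * (z - t)) + t = (u * u) * (z - t) + t" by (simp add: algebra_simps)
      ultimately have "z \<in> (\<lambda>x. u * x + t) ` P" using uu by simp
      then show "z \<in> (\<lambda>x. u * x + t) ` P \<inter> {0..<n}" using x n by simp
    qed
    show "(\<lambda>y. u * (y - t) mod n) ` ((\<lambda>x. u * x + t) ` P \<inter> {0..<n}) \<subseteq> P \<inter> {0..<n}"
    proof
      fix z assume "z \<in> (\<lambda>y. u * (y - t) mod n) ` ((\<lambda>x. u * x + t) ` P \<inter> {0..<n})"
      then obtain x where x: "x \<in> P" "z = (u * (u * x)) mod n" by auto
      have "u * (u * x) = (u * u) * x" by (simp add: algebra_simps)
      then have "z = x mod n" using x(2) uu by (metis mult_1)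
      then show "z \<in> P \<inter> {0..<n}" using x P n periodic_mod_iff by simp
    qed
  qed
  then show ?thesis unfolding period_card_def by (metis bij_betw_same_card)
qed

lemma period_card_translate: "0 < n \<Longrightarrow> periodic n P \<Longrightarrow> period_card n ((+) t ` P) = period_card n P"
  using period_card_affine[of n P 1 t] by (simp add: add.commute[of t] cong: image_cong_simp)

lemma period_card_uminus: "0 < n \<Longrightarrow> periodic n P \<Longrightarrow> period_card n (uminus ` P) = period_card n P"
  using period_card_affine[of n P "-1" 0] by simp

lemma periodic_translate: "periodic n P \<Longrightarrow> periodic n ((+) t ` P)"
  using periodic_plus[of n P "{t}"] by (simp add: set_plus_def image_def add.commute Bex_def)

section \<open>Hamidoune's isoperimetric method: fragments, atoms and Mann's theorem\<close>

definition fragment :: "int \<Rightarrow> int set \<Rightarrow> int set \<Rightarrow> bool" where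
  "fragment n S Y \<longleftrightarrow> periodic n Y \<and> Y \<noteq> {} \<and> Y + S \<noteq> UNIV"

text \<open>Cardinalities are subtracted because \<open>S\<close> need not contain 0, so
  \<open>Y\<close> need not lie in \<open>Y + S\<close>. Minimality is not part of
  \<open>fragment\<close>: an atom is a fragment of least boundary and, among those, of least
  size.\<close>

definition boundary :: "int \<Rightarrow> int set \<Rightarrow> int set \<Rightarrow> int" where
  "boundary n S Y = int (period_card n (Y + S)) - int (period_card n Y)"

lemma translate_plus: "(+) t ` Y + S = (+) t ` (Y + S)" for S :: "int set"
  by (auto simp: set_plus_def image_iff algebra_simps) (metis add.assoc)+

lemma translate_UNIV: "(+) t ` Y = UNIV \<longleftrightarrow> Y = UNIV" for Y :: "int set"
proof
  assume "(+) t ` Y = UNIV"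
  then have "t + x \<in> (+) t ` Y" for x by simp
  then show "Y = UNIV" by (auto simp: image_iff)
next
  assume "Y = UNIV" then show "(+) t ` Y = UNIV" by simp
qed

lemma fragment_translate: "fragment n S Y \<Longrightarrow> fragment n S ((+) t ` Y)"
  unfolding fragment_def by (auto simp: periodic_translate translate_plus translate_UNIV)

lemma boundary_translate: "0 < n \<Longrightarrow> periodic n Y \<Longrightarrow> boundary n S ((+) t ` Y) = boundary n S Y"
  unfolding boundary_def by (simp add: translate_plus period_card_translate periodic_plus)

text \<open>Subtracting an element of \<open>S\<close> from a point outside \<open>Y + S\<close>
  never leads into \<open>Y\<close>. Hence complements exchange \<open>S\<close> and
  \<open>- S\<close> without raising the boundary.\<close>

lemma fragment_dual:
  assumes n: "0 < n" and Y: "fragment n S Y"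
  shows "fragment n (uminus ` S) (- (Y + S))" "boundary n (uminus ` S) (- (Y + S)) \<le> boundary n S Y"
proof -
  have sub: "- (Y + S) + uminus ` S \<subseteq> - Y"
  proof
    fix z assume "z \<in> - (Y + S) + uminus ` S"
    then obtain a s where a: "a \<notin> Y + S" "s \<in> S" "z = a - s" by (auto elim!: set_plus_elim)
    show "z \<in> - Y"
    proof
      assume "z \<in> Y"
      then have "z + s \<in> Y + S" using a by (intro set_plus_intro)
      then show False using a by simp
    qed
  qed
  show "fragment n (uminus ` S) (- (Y + S))"
    using Y sub unfolding fragment_def by (auto intro: periodic_Compl periodic_plus)
  have "period_card n (- (Y + S) + uminus ` S) \<le> period_card n (- Y)" using sub by (rule period_card_mono)
  then show "boundary n (uminus ` S) (- (Y + S)) \<le> boundary n S Y"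
    using period_card_Compl[of n Y] period_card_Compl[of n "Y + S"] unfolding boundary_def by linarith
qed

lemma plus_Un_distrib: "(A \<union> B) + S = (A + S) \<union> (B + S)" for S :: "int set"
  by (auto simp: set_plus_def)

text \<open>By submodularity of the boundary, a minimal fragment (an atom) and a translate of it that meets it coincide.
  If the union fills everything, submodularity is replaced by the comparison with a dual fragment.\<close>

lemma atom_subgroup:
  assumes n: "0 < n" and S: "S \<noteq> {}" and K: "fragment n S K" "0 \<in> K"
    and min1: "\<And>Y. fragment n S Y \<Longrightarrow> boundary n S K \<le> boundary n S Y \<and> (boundary n S Y = boundary n S K \<longrightarrow> period_card n K \<le> period_card n Y)"
    and min2: "\<And>Y. fragment n (uminus ` S) Y \<Longrightarrow> boundary n S K \<le> boundary n (uminus ` S) Y \<and> 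
       (boundary n (uminus ` S) Y = boundary n S K \<longrightarrow> period_card n K \<le> period_card n Y)"
    and x: "x \<in> K" and y: "y \<in> K"
  shows "y - x \<in> K"
proof -
  define B where "B = (+) (- x) ` K"
  have perK: "periodic n K" using K fragment_def by blast
  have fB: "fragment n S B" unfolding B_def using K(1) by (rule fragment_translate)
  have perB: "periodic n B" using fB fragment_def by blast
  have bB: "boundary n S B = boundary n S K" unfolding B_def using n perK by (rule boundary_translate)
  have cB: "period_card n B = period_card n K" unfolding B_def using n perK by (rule period_card_translate)
  have 0: "0 \<in> K \<inter> B" using K(2) x unfolding B_def by auto
  have perI: "periodic n (K \<inter> B)" using perK perB by (rule periodic_Int)
  have posI: "0 < period_card n (K \<inter> B)" using period_card_pos[OF n perI] 0 by blast
  have IS: "(K \<inter> B) + S \<subseteq> (K + S) \<inter> (B + S)" by (auto simp: set_plus_def)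
  have fI: "fragment n S (K \<inter> B)" using perI 0 IS K(1) unfolding fragment_def by blast
  have sub: "period_card n ((K \<inter> B) + S) \<le> period_card n ((K + S) \<inter> (B + S))" using IS by (rule period_card_mono)
  have mod1: "period_card n ((K + S) \<union> (B + S)) + period_card n ((K + S) \<inter> (B + S)) = period_card n (K + S) + period_card n (B + S)"
    by (rule period_card_Un_Int)
  have mod2: "period_card n (K \<union> B) + period_card n (K \<inter> B) = period_card n K + period_card n B" by (rule period_card_Un_Int)
  have I: "boundary n S (K \<inter> B) \<ge> boundary n S K" using min1 fI by blast
  have U: "(K \<union> B) + S \<noteq> UNIV"
  proof
    assume "(K \<union> B) + S = UNIV"
    then have "period_card n ((K + S) \<union> (B + S)) = nat n" using plus_Un_distrib period_card_UNIV by metis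
    then have e: "period_card n ((K + S) \<inter> (B + S)) + nat n = period_card n (K + S) + period_card n (B + S)" using mod1 by simp
    have f: "fragment n (uminus ` S) (- (B + S))" "boundary n (uminus ` S) (- (B + S)) \<le> boundary n S B"
      using fragment_dual[OF n fB] by auto
    \<comment> \<open>Minimality also over \<open>- S\<close> forces the dual fragment to have the
      boundary of \<open>K\<close>, so the tie-break on sizes applies to it. The consequence is that
      \<open>K \<inter> B\<close>, nonempty because of 0, has a smaller boundary than
      \<open>K\<close>.\<close>
    then have "period_card n K \<le> period_card n (- (B + S))" using min2[OF f(1)] bB by auto
    then have "period_card n ((K + S) \<inter> (B + S)) + period_card n K \<le> period_card n (K + S)"
      using e period_card_Compl[of n "B + S"] by linarith
    then have "int (period_card n ((K \<inter> B) + S)) \<le> boundary n S K" using sub unfolding boundary_def by linarith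
    then show False using I posI unfolding boundary_def by linarith
  qed
  have "fragment n S (K \<union> B)" unfolding fragment_def using U perK perB 0 periodic_Un by blast
  then have "boundary n S (K \<union> B) \<ge> boundary n S K" using min1 by blast
  then have "boundary n S (K \<inter> B) \<le> boundary n S K"
    using mod1 mod2 sub bB cB I unfolding boundary_def plus_Un_distrib by linarith
  then have "boundary n S (K \<inter> B) = boundary n S K" using I by simp
  then have "period_card n K \<le> period_card n (K \<inter> B)" using min1 fI by blast
  then have "K \<inter> B = K" using periodic_subset_period_card_eq[OF n perI perK] by blast
  then have "K = B" using periodic_subset_period_card_eq[OF n perK perB] cB by (metis Int_lower2 order_refl)
  moreover have "y - x \<in> B" unfolding B_def using y by (auto simp: image_iff)
  ultimately show ?thesis by simp
qed

lemma int_subgroup_eq_multiples: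
  fixes K :: "int set"
  assumes diff: "\<And>x y. x \<in> K \<Longrightarrow> y \<in> K \<Longrightarrow> y - x \<in> K" and n: "0 < n" "n \<in> K"
  obtains h where "0 < h" "h dvd n" "K = {x. h dvd x}"
proof -
  define h where "h = (LEAST h::nat. 0 < h \<and> int h \<in> K)"
  have ex: "0 < nat n \<and> int (nat n) \<in> K" using n by simp
  have h: "0 < h" "int h \<in> K" unfolding h_def using LeastI[of "\<lambda>h. 0 < h \<and> int h \<in> K", OF ex] by auto
  have least: "h \<le> m" if "0 < m" "int m \<in> K" for m unfolding h_def using that by (intro Least_le) auto
  have 0: "0 \<in> K" using diff[OF n(2) n(2)] by simp
  have neg: "- x \<in> K" if "x \<in> K" for x using diff[OF that 0] by simp
  have add: "x + y \<in> K" if "x \<in> K" "y \<in> K" for x y using diff[OF neg[OF that(1)] that(2)] by (simp add: add.commute)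
  have mulnat: "int m * int h \<in> K" for m
    by (induction m) (auto simp: 0 algebra_simps intro: add h)
  have mul: "t * int h \<in> K" for t
  proof (cases "t \<ge> 0")
    case True then show ?thesis using mulnat[of "nat t"] by simp
  next
    case False then show ?thesis using neg[OF mulnat[of "nat (- t)"]] by simp
  qed
  have "K = {x. int h dvd x}"
  proof (intro set_eqI iffI)
    fix x assume x: "x \<in> K"
    have "x - (x div int h) * int h \<in> K" using diff[OF mul x] .
    then have m: "x mod int h \<in> K" by (simp add: minus_div_mult_eq_mod)
    have "x mod int h = 0"
    proof (rule ccontr)
      assume nz: "x mod int h \<noteq> 0"
      have r: "0 \<le> x mod int h" "x mod int h < int h" using h(1) by auto
      then have "h \<le> nat (x mod int h)" using m nz by (intro least) auto
      then show False using r by linarith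
    qed
    then show "x \<in> {x. int h dvd x}" by auto
  next
    fix x assume "x \<in> {x. int h dvd x}"
    then show "x \<in> K" using mul by (auto simp: dvd_def mult.commute)
  qed
  then show ?thesis using that[of "int h"] h n by auto
qed

text \<open>Mann's theorem for cyclic groups.\<close>

lemma isoperimetric_multiples:
  assumes n: "0 < n" and S: "periodic n S" "S \<noteq> {}" and Y: "fragment n S Y" "boundary n S Y \<le> int (period_card n S) - 2"
  obtains h where "0 < h" "h dvd n" "{x. h dvd x} + S \<noteq> UNIV"
    "int (period_card n ({x. h dvd x} + S)) \<le> int (period_card n S) + int (period_card n {x. h dvd x}) - 2"
proof -
  \<comment> \<open>Both signs compete, since duality leads from \<open>S\<close> to
    \<open>- S\<close>. The weight \<open>w\<close> codes the lexicographic order, boundary before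
    size: adding \<open>n\<close> makes the boundary nonnegative, and no \<open>period_card\<close>
    reaches \<open>nat n + 1\<close>.\<close>
  define F where "F = {(T, Y). (T = S \<or> T = uminus ` S) \<and> fragment n T Y}"
  define w where "w = (\<lambda>(T, Y). nat (boundary n T Y + n) * (nat n + 1) + period_card n Y)"
  have "(S, Y) \<in> F" unfolding F_def using Y by simp
  then obtain q where q: "q \<in> F" "\<And>z. z \<in> F \<Longrightarrow> w q \<le> w z"
    using ex_has_least_nat[of "\<lambda>z. z \<in> F" "(S,Y)" w] by blast
  obtain T K0 where TK: "q = (T, K0)" by fastforce
  have T: "T = S \<or> T = uminus ` S" and K0: "fragment n T K0" using q TK unfolding F_def by auto
  have lex: "boundary n T K0 \<le> boundary n T' Z \<and> (boundary n T' Z = boundary n T K0 \<longrightarrow> period_card n K0 \<le> period_card n Z)"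
    if "T' = S \<or> T' = uminus ` S" "fragment n T' Z" for T' Z
  proof -
    have bdn: "boundary n R Q + n \<ge> 0" for R Q using period_card_le[of n Q] n unfolding boundary_def by linarith
    have "w (T, K0) \<le> w (T', Z)" using q(2)[of "(T', Z)"] that TK unfolding F_def by auto
    then have le: "nat (boundary n T K0 + n) * (nat n + 1) + period_card n K0 \<le> nat (boundary n T' Z + n) * (nat n + 1) + period_card n Z"
      unfolding w_def by simp
    have "nat (boundary n T K0 + n) \<le> nat (boundary n T' Z + n)"
    proof (rule ccontr)
      assume "\<not> ?thesis"
      then have "nat (boundary n T' Z + n) + 1 \<le> nat (boundary n T K0 + n)" by simp
      then have "(nat (boundary n T' Z + n) + 1) * (nat n + 1) \<le> nat (boundary n T K0 + n) * (nat n + 1)" by (intro mult_right_mono) auto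
      then show False using le period_card_le[of n Z] by (simp add: algebra_simps)
    qed
    then have "boundary n T K0 \<le> boundary n T' Z" using bdn[of T K0] bdn[of T' Z] by linarith
    then show ?thesis using le by auto
  qed
  have perT: "periodic n T" "T \<noteq> {}" using T S periodic_uminus by auto
  have negT: "uminus ` T = S \<or> uminus ` T = uminus ` S" using T by (auto simp: image_image)
  obtain k0 where k0: "k0 \<in> K0" using K0 fragment_def by blast
  define K where "K = (+) (- k0) ` K0"
  have perK0: "periodic n K0" using K0 fragment_def by blast
  have K: "fragment n T K" "0 \<in> K" "boundary n T K = boundary n T K0" "period_card n K = period_card n K0"
    unfolding K_def
    using k0 fragment_translate[OF K0, of "- k0"] boundary_translate[OF n perK0, of T "- k0"] period_card_translate[OF n perK0, of "- k0"]
    by (force simp del: add_uminus_conv_diff uminus_add_conv_diff)+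
  have sg: "y - x \<in> K" if "x \<in> K" "y \<in> K" for x y
  proof (rule atom_subgroup[OF n perT(2) K(1,2) _ _ that])
    show "boundary n T K \<le> boundary n T Z \<and> (boundary n T Z = boundary n T K \<longrightarrow> period_card n K \<le> period_card n Z)" if "fragment n T Z" for Z
      using lex[OF T that] K by simp
    show "boundary n T K \<le> boundary n (uminus ` T) Z \<and> (boundary n (uminus ` T) Z = boundary n T K \<longrightarrow> period_card n K \<le> period_card n Z)"
      if "fragment n (uminus ` T) Z" for Z
      using lex[OF negT that] K by simp
  qed
  have "n \<in> K" using K(1,2) periodicD[of n K 0 n] unfolding fragment_def by simp
  then obtain h where h: "0 < h" "h dvd n" "K = {x. h dvd x}" using int_subgroup_eq_multiples[OF sg n] by blast
  have cT: "period_card n T = period_card n S" using T period_card_uminus[OF n S(1)] by auto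
  have bK: "boundary n T K \<le> int (period_card n S) - 2" using lex[of S Y] Y K by auto
  \<comment> \<open>If the atom was found for \<open>- S\<close>, the symmetry of the subgroup
    \<open>K\<close> makes \<open>K - S\<close> the reflection of \<open>K + S\<close>, so the
    conclusion can be stated for \<open>S\<close>.\<close>
  have KS: "uminus ` (K + S) = K + uminus ` S"
  proof -
    have "uminus ` (K + S) = uminus ` K + uminus ` S"
      by (auto simp: set_plus_def image_iff) (metis add_uminus_conv_diff minus_add minus_minus uminus_add_conv_diff)+
    moreover have "uminus ` K = K" unfolding h(3) by (auto simp: image_iff) (metis dvd_minus_iff minus_minus)
    ultimately show ?thesis by simp
  qed
  have perKS: "periodic n (K + S)" using K(1) periodic_plus fragment_def by blast
  have cKT: "period_card n (K + T) = period_card n (K + S)" using T KS period_card_uminus[OF n perKS] by auto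
  have "K + S \<noteq> UNIV"
  proof
    assume U: "K + S = UNIV"
    then have "period_card n (K + T) = nat n" using cKT period_card_UNIV by simp
    moreover have "periodic n (K + T)" using K(1) periodic_plus fragment_def by blast
    ultimately have "K + T = UNIV"
      using periodic_subset_period_card_eq[OF n, of "K + T" UNIV] period_card_UNIV[of n] by (simp add: periodic_def)
    then show False using K(1) fragment_def by blast
  qed
  then show ?thesis using that[OF h(1,2)] bK cKT unfolding boundary_def h(3)[symmetric] by simp
qed

section \<open>Difference sets of integers\<close>

definition difference_set :: "int set \<Rightarrow> int set" where
  "difference_set A = {a - b | a b. a \<in> A \<and> b \<in> A}"

definition residue_set :: "int \<Rightarrow> int set \<Rightarrow> int set" where
  "residue_set h A = (\<lambda>a. a mod h) ` A"

text \<open>The preimage in the integers of the image of \<open>A\<close> modulo \<open>h\<close>: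
  the periodic counterpart of \<open>residue_set\<close>, which consists of representatives.\<close>

definition saturate :: "int \<Rightarrow> int set \<Rightarrow> int set" where
  "saturate h A = {x. \<exists>a\<in>A. h dvd x - a}"

lemma difference_set_eq_image: "difference_set A = (\<lambda>(a, b). a - b) ` (A \<times> A)"
  unfolding difference_set_def by auto

lemma finite_difference_set: "finite A \<Longrightarrow> finite (difference_set A)"
  unfolding difference_set_eq_image by simp

lemma diffsI: "a \<in> A \<Longrightarrow> b \<in> A \<Longrightarrow> a - b \<in> difference_set A"
  unfolding difference_set_def by blast

lemma periodic_saturate: "periodic h (saturate h A)"
  unfolding periodic_def saturate_def
proof (intro allI impI)
  fix x y assume *: "h dvd x - y" "x \<in> {x. \<exists>a\<in>A. h dvd x - a}"
  then obtain a where a: "a \<in> A" "h dvd x - a" by auto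
  have "y - a = (x - a) - (x - y)" by simp
  then have "h dvd y - a" using a * by (metis dvd_diff)
  then show "y \<in> {x. \<exists>a\<in>A. h dvd x - a}" using a by blast
qed

lemma period_card_saturate: "0 < h \<Longrightarrow> period_card h (saturate h A) = card (residue_set h A)"
proof -
  assume h: "0 < h"
  have "saturate h A \<inter> {0..<h} = residue_set h A"
  proof (intro set_eqI iffI)
    fix x assume "x \<in> saturate h A \<inter> {0..<h}"
    then obtain a where a: "a \<in> A" "h dvd x - a" "0 \<le> x" "x < h" by (auto simp: saturate_def)
    then have "x = a mod h" by (metis mod_eq_dvd_iff mod_pos_pos_trivial)
    then show "x \<in> residue_set h A" using a unfolding residue_set_def by blast
  next
    fix x assume "x \<in> residue_set h A"
    then obtain a where a: "a \<in> A" "x = a mod h" by (auto simp: residue_set_def)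
    then have "h dvd x - a" by (metis mod_eq_dvd_iff mod_mod_trivial)
    then show "x \<in> saturate h A \<inter> {0..<h}" using a h by (auto simp: saturate_def)
  qed
  then show ?thesis unfolding period_card_def by simp
qed

lemma period_card_multiple:
  assumes g: "0 < g" "g dvd h" and h: "0 < h" and P: "periodic g P"
  shows "period_card h P = nat (h div g) * period_card g P"
proof -
  define N where "N = h div g"
  have hN: "h = N * g" and N: "0 < N" unfolding N_def using g h by (auto simp: pos_imp_zdiv_pos_iff zdvd_imp_le)
  have mem: "x + i * g \<in> P \<longleftrightarrow> x \<in> P" for x i
    using periodicD[OF P, of x "x + i * g"] periodicD[OF P, of "x + i * g" x] by auto
  have "bij_betw (\<lambda>(i, x). x + i * g) ({0..<N} \<times> (P \<inter> {0..<g})) (P \<inter> {0..<h})"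
  proof (rule bij_betw_byWitness[where f' = "\<lambda>y. (y div g, y mod g)"])
    show "\<forall>a\<in>{0..<N} \<times> (P \<inter> {0..<g}). ((case a of (i, x) \<Rightarrow> x + i * g) div g, (case a of (i, x) \<Rightarrow> x + i * g) mod g) = a"
      using g by auto
    show "\<forall>a'\<in>P \<inter> {0..<h}. (case (a' div g, a' mod g) of (i, x) \<Rightarrow> x + i * g) = a'" by simp
    show "(\<lambda>(i, x). x + i * g) ` ({0..<N} \<times> (P \<inter> {0..<g})) \<subseteq> P \<inter> {0..<h}"
    proof
      fix z assume "z \<in> (\<lambda>(i, x). x + i * g) ` ({0..<N} \<times> (P \<inter> {0..<g}))"
      then obtain i x where *: "x \<in> P" "0 \<le> i" "i < N" "0 \<le> x" "x < g" "z = x + i * g" by auto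
      have "(i + 1) * g \<le> N * g" using * g by (intro mult_right_mono) auto
      moreover have "0 \<le> i * g" using * g by simp
      ultimately have "0 \<le> z" "z < h" using * hN by (auto simp: algebra_simps)
      then show "z \<in> P \<inter> {0..<h}" using mem[of x i] * by auto
    qed
    show "(\<lambda>y. (y div g, y mod g)) ` (P \<inter> {0..<h}) \<subseteq> {0..<N} \<times> (P \<inter> {0..<g})"
    proof clarsimp
      fix y assume *: "y \<in> P" "0 \<le> y" "y < h"
      have "y mod g \<in> P" using * P periodic_mod_iff by simp
      moreover have "y div g < N"
      proof (rule ccontr)
        assume "\<not> y div g < N"
        then have "N * g \<le> y div g * g" using g by (intro mult_right_mono) auto
        moreover have "0 \<le> y mod g" using g by simp
        ultimately show False using * hN div_mult_mod_eq[of y g] by linarith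
      qed
      ultimately show "0 \<le> y div g \<and> y div g < N \<and> y mod g \<in> P \<and> 0 \<le> y mod g \<and> y mod g < g"
        using * g by (simp add: pos_imp_zdiv_nonneg_iff)
    qed
  qed
  then have "card ({0..<N} \<times> (P \<inter> {0..<g})) = period_card h P" unfolding period_card_def by (rule bij_betw_same_card)
  then show ?thesis unfolding period_card_def N_def by (simp add: card_cartesian_product)
qed

lemma card_residue_set_le: "0 < h \<Longrightarrow> card (residue_set h A) \<le> nat h"
  using period_card_saturate[of h A] period_card_le[of h "saturate h A"] by simp

text \<open>Mann's theorem for the residues \<open>X\<close> of \<open>A\<close> and the fragment
  \<open>- X\<close>, whose sum is the set of difference residues. The subgroup \<open>H\<close> of
  multiples of \<open>g\<close> has \<open>h div g\<close> elements modulo \<open>h\<close>, so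
  \<open>|H + X| \<le> |X| + |H| - 2\<close> becomes the last inequality; for \<open>g = h\<close>
  it would be absurd.\<close>

lemma few_difference_residue_set:
  assumes h: "0 < h" and A: "A \<noteq> {}" 
    and q: "card (residue_set h (difference_set A)) < nat h" "card (residue_set h (difference_set A)) + 2 \<le> 2 * card (residue_set h A)"
  obtains g where "0 < g" "g dvd h" "g < h" "card (residue_set g A) < nat g"
    "int (card (residue_set g A)) * (h div g) \<le> int (card (residue_set h A)) + h div g - 2"
proof -
  let ?X = "saturate h A"
  have per: "periodic h ?X" by (rule periodic_saturate)
  have X: "?X \<noteq> {}" using A unfolding saturate_def by (metis (mono_tags, lifting) cancel_comm_monoid_add_class.diff_cancel dvd_0_right empty_iff ex_in_conv mem_Collect_eq)
  have XX: "uminus ` ?X + ?X = saturate h (difference_set A)"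
  proof (intro set_eqI iffI)
    fix z assume "z \<in> uminus ` ?X + ?X"
    then obtain x y a b where *: "z = - x + y" "h dvd x - a" "h dvd y - b" "a \<in> A" "b \<in> A"
      unfolding saturate_def by (auto elim!: set_plus_elim)
    have "z - (b - a) = (y - b) - (x - a)" using * by simp
    then have "h dvd z - (b - a)" using * by (metis dvd_diff)
    then show "z \<in> saturate h (difference_set A)" unfolding saturate_def using diffsI * by blast
  next
    fix z assume "z \<in> saturate h (difference_set A)"
    then obtain a b where *: "a \<in> A" "b \<in> A" "h dvd z - (a - b)" unfolding saturate_def difference_set_def by auto
    have "z + b \<in> ?X" using * unfolding saturate_def by (auto simp: algebra_simps)
    moreover have "- b \<in> uminus ` ?X" using * unfolding saturate_def by force
    ultimately have "- b + (z + b) \<in> uminus ` ?X + ?X" by (intro set_plus_intro)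
    then show "z \<in> uminus ` ?X + ?X" by simp
  qed
  have c: "period_card h (uminus ` ?X) = period_card h ?X" using period_card_uminus[OF h per] .
  have "fragment h ?X (uminus ` ?X)"
    unfolding fragment_def using X XX periodic_uminus[OF per] period_card_saturate[OF h, of "difference_set A"] period_card_UNIV[of h] q by auto
  moreover have "boundary h ?X (uminus ` ?X) \<le> int (period_card h ?X) - 2"
    unfolding boundary_def XX c period_card_saturate[OF h] using q by linarith
  ultimately obtain g where g: "0 < g" "g dvd h" "{x. g dvd x} + ?X \<noteq> UNIV"
    "int (period_card h ({x. g dvd x} + ?X)) \<le> int (period_card h ?X) + int (period_card h {x. g dvd x}) - 2"
    using isoperimetric_multiples[OF h per X] by blast
  have gX: "{x. g dvd x} + ?X = saturate g A"
  proof (intro set_eqI iffI)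
    fix z assume "z \<in> {x. g dvd x} + ?X"
    then obtain x y a where *: "z = x + y" "g dvd x" "h dvd y - a" "a \<in> A"
      unfolding saturate_def by (auto elim!: set_plus_elim)
    have "g dvd x + (y - a)" using * g dvd_trans by (intro dvd_add) blast+
    then show "z \<in> saturate g A" unfolding saturate_def using * by (auto simp: algebra_simps)
  next
    fix z assume "z \<in> saturate g A"
    then obtain a where *: "a \<in> A" "g dvd z - a" unfolding saturate_def by auto
    have "a \<in> ?X" using * unfolding saturate_def by force
    then have "(z - a) + a \<in> {x. g dvd x} + ?X" using * by (intro set_plus_intro) auto
    then show "z \<in> {x. g dvd x} + ?X" by simp
  qed
  have m: "{x. g dvd x} = saturate g {0}" unfolding saturate_def by simp
  have c1: "period_card h (saturate g B) = nat (h div g) * card (residue_set g B)" for B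
    using period_card_multiple[OF g(1,2) h periodic_saturate] period_card_saturate[OF g(1)] by simp
  have r0: "card (residue_set g {0}) = 1" unfolding residue_set_def by simp
  have hg: "0 < h div g" using g h by (simp add: pos_imp_zdiv_pos_iff zdvd_imp_le)
  have ineq: "int (card (residue_set g A)) * (h div g) \<le> int (card (residue_set h A)) + h div g - 2"
  proof -
    have "int (period_card h (saturate g A)) \<le> int (card (residue_set h A)) + int (period_card h (saturate g {0})) - 2"
      using g(4) unfolding gX period_card_saturate[OF h] by (simp only: m)
    then show ?thesis using hg unfolding c1 r0 by (simp add: mult.commute)
  qed
  have "card (residue_set g A) \<noteq> nat g"
    using periodic_subset_period_card_eq[OF g(1) periodic_saturate[of g A], of UNIV] g(3) period_card_UNIV[of g] period_card_saturate[OF g(1), of A]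
    unfolding gX by (auto simp: periodic_def)
  then have lt: "card (residue_set g A) < nat g" using card_residue_set_le[OF g(1), of A] by simp
  have "g \<noteq> h" using ineq h by auto
  then have "g < h" using g h zdvd_imp_le by fastforce
  then show ?thesis using that g lt ineq by blast
qed

section \<open>Integer sets with few differences are dense in their hull\<close>

lemma card_diff_ge:
  fixes A B :: "int set"
  assumes "finite A" "finite B" "A \<noteq> {}" "B \<noteq> {}"
  shows "card A + card B \<le> card {a - b | a b. a \<in> A \<and> b \<in> B} + 1"
proof -
  let ?D = "{a - b | a b. a \<in> A \<and> b \<in> B}"
  have fin: "finite ?D" using assms finite_image_set2[of "\<lambda>a. a \<in> A" "\<lambda>b. b \<in> B"] by simp
  let ?U = "(\<lambda>a. a - Max B) ` A" and ?V = "(\<lambda>b. Max A - b) ` B"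
  have U: "card ?U = card A" by (intro card_image inj_onI) simp
  have V: "card ?V = card B" by (intro card_image inj_onI) simp
  \<comment> \<open>\<open>Max A - Max B\<close> is the largest element of \<open>?U\<close> and the
    smallest of \<open>?V\<close>.\<close>
  have "?U \<inter> ?V \<subseteq> {Max A - Max B}"
  proof
    fix x assume "x \<in> ?U \<inter> ?V"
    then obtain a b where ab: "a \<in> A" "b \<in> B" "x = a - Max B" "x = Max A - b" by auto
    then have "a \<le> Max A" "b \<le> Max B" using assms by auto
    then show "x \<in> {Max A - Max B}" using ab by simp
  qed
  then have "card (?U \<inter> ?V) \<le> 1" using card_mono[of "{Max A - Max B}"] by fastforce
  moreover have "card (?U \<union> ?V) + card (?U \<inter> ?V) = card A + card B"
    using card_Un_Int[of ?U ?V] assms U V by simp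
  moreover have "?U \<union> ?V \<subseteq> ?D" using Max_in[OF assms(1,3)] Max_in[OF assms(2,4)] by blast
  then have "card (?U \<union> ?V) \<le> card ?D" using fin card_mono by blast
  ultimately show ?thesis by linarith
qed

lemma card_eq_sum_fibres: "finite A \<Longrightarrow> card A = (\<Sum>c\<in>f ` A. card {a \<in> A. f a = c})"
  using sum.image_gen[of A "\<lambda>_. 1::nat" f] by simp

lemma card_difference_set_ge_residue_set:
  assumes A: "A \<subseteq> {0..l}" "0 \<in> A" "l \<in> A" and l: "0 < l"
  shows "card (residue_set l (difference_set A)) + card A \<le> card (difference_set A)"
proof -
  have finA: "finite A" using A finite_subset by auto
  define D where "D = difference_set A"
  have finD: "finite D" unfolding D_def using finA by (rule finite_difference_set)
  have D: "D \<subseteq> {-l..l}"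
  proof
    fix d assume "d \<in> D"
    then obtain a b where "d = a - b" "a \<in> A" "b \<in> A" unfolding D_def difference_set_def by auto
    moreover have "a \<in> {0..l}" "b \<in> {0..l}" using A calculation by auto
    ultimately show "d \<in> {-l..l}" by auto
  qed
  let ?U = "D \<inter> {0..<l}" and ?V = "(\<lambda>x. x + l) ` (D \<inter> {-l..<0})"
  have "residue_set l D \<subseteq> ?U \<union> ?V"
  proof
    fix c assume "c \<in> residue_set l D"
    then obtain d where d: "d \<in> D" "c = d mod l" unfolding residue_set_def by auto
    have 0: "0 \<in> D" unfolding D_def using diffsI[OF A(2) A(2)] by simp
    consider "d = l" | "0 \<le> d" "d < l" | "- l \<le> d" "d < 0" using D d by force
    then show "c \<in> ?U \<union> ?V"
    proof cases
      case 1 then show ?thesis using d 0 l by simp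
    next
      case 2 then show ?thesis using d by simp
    next
      case 3
      have "(d + l) mod l = d + l" using 3 by (intro mod_pos_pos_trivial) auto
      then have "c = d + l" using d by simp
      then show ?thesis using d 3 by auto
    qed
  qed
  then have r: "card (residue_set l D) \<le> card (?U \<union> ?V)" using finD by (intro card_mono) auto
  have "A - {l} \<subseteq> ?U \<inter> ?V"
  proof
    fix a assume a: "a \<in> A - {l}"
    have "a - 0 \<in> D" "a - l \<in> D" unfolding D_def using a A diffsI by blast+
    moreover have "a \<in> {0..l}" "a \<noteq> l" using a A by auto
    ultimately have "a \<in> ?U" "a - l \<in> D \<inter> {-l..<0}" by auto
    then show "a \<in> ?U \<inter> ?V" by (intro IntI image_eqI[where x = "a - l"]) auto
  qed
  then have "card (A - {l}) \<le> card (?U \<inter> ?V)" using finD by (intro card_mono) auto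
  then have i: "card A \<le> card (?U \<inter> ?V) + 1" using A finA by simp
  have "card (?U \<union> ?V) + card (?U \<inter> ?V) = card ?U + card ?V" using card_Un_Int[of ?U ?V] finD by simp
  moreover have "card ?V = card (D \<inter> {-l..<0})" by (intro card_image inj_onI) simp
  moreover have "card (?U \<union> (D \<inter> {-l..<0})) = card ?U + card (D \<inter> {-l..<0})"
    using finD by (intro card_Un_disjoint) auto
  \<comment> \<open>The difference \<open>l\<close> lies in neither window; as a third difference
    with residue 0 it makes up for the element lost in \<open>A - {l}\<close>.\<close>
  moreover have "card (insert l (?U \<union> (D \<inter> {-l..<0}))) = card (?U \<union> (D \<inter> {-l..<0})) + 1"
    using finD l by (subst card_insert_disjoint) auto
  moreover have "l - 0 \<in> D" unfolding D_def using A by (intro diffsI)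
  then have "card (insert l (?U \<union> (D \<inter> {-l..<0}))) \<le> card D" using finD by (intro card_mono) auto
  ultimately show ?thesis using r i unfolding D_def[symmetric] by linarith
qed

lemma finite_int_segment: "finite {x \<in> {0..<l::int}. P x}"
  by (rule finite_subset[of _ "{0..<l}"]) auto

lemma card_residue_class:
  assumes h: "0 < h" "h dvd l" and l: "0 < l"
  shows "card {x \<in> {0..<l}. x mod h = c mod h} = nat (l div h)"
proof -
  have "saturate h {c} \<inter> {0..<l} = {x \<in> {0..<l}. x mod h = c mod h}"
    unfolding saturate_def by (auto simp: mod_eq_dvd_iff)
  then have "card {x \<in> {0..<l}. x mod h = c mod h} = period_card l (saturate h {c})" unfolding period_card_def by simp
  also have "\<dots> = nat (l div h) * card (residue_set h {c})"
    using period_card_multiple[OF h l periodic_saturate] period_card_saturate[OF h(1)] by simp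
  finally show ?thesis unfolding residue_set_def by simp
qed

text \<open>Reduce modulo \<open>l\<close>: the residue of each element of \<open>A\<close> other than \<open>l\<close> is attained by two
  differences (three for \<open>0\<close>). If fewer than $2|A| - 3$ residues occur as differences, Mann's theorem provides a
  subgroup \<open>h\<close> whose cosets are nearly filled by \<open>A\<close>; take \<open>h\<close> minimal and count
  the differences coset by coset.\<close>

lemma small_differences_imp_dense:
  assumes A: "A \<subseteq> {0..l}" "0 \<in> A" "l \<in> A" and l: "0 < l"
    and gcd: "\<And>h. 2 \<le> h \<Longrightarrow> \<exists>a\<in>A. \<not> h dvd a"
    and small: "card (difference_set A) + 7 \<le> 3 * card A"
  shows "l + 7 \<le> 2 * int (card A)"
proof (rule ccontr)
  assume notdense: "\<not> ?thesis"
  have finA: "finite A" using A finite_subset by auto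
  define D where "D = difference_set A"
  have finD: "finite D" unfolding D_def using finA by (rule finite_difference_set)
  define k where "k = int (card A)"
  have "A \<noteq> {}" using A by blast
  then have DA: "2 * card A \<le> card D + 1"
    using card_diff_ge[of A A] finA unfolding D_def difference_set_def by auto
  have kl: "k \<le> l" using notdense DA small unfolding D_def k_def by linarith
  have resA: "residue_set h (A - {l}) = residue_set h A" if "h dvd l" for h
  proof -
    have "l mod h = 0 mod h" using that by simp
    moreover have "0 \<in> A - {l}" using A l by simp
    ultimately show ?thesis using A(3) unfolding residue_set_def by (metis (no_types, lifting) image_eqI image_insert insert_Diff insert_absorb)
  qed
  have bound: "x \<in> {0..<l}" if "x \<in> A - {l}" for x using that A(1) by force
  have "residue_set l (A - {l}) = A - {l}" unfolding residue_set_def using bound by (force simp: image_iff)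
  then have resl: "residue_set l A = A - {l}" using resA[of l] by simp
  have cardA': "int (card (A - {l})) = k - 1" unfolding k_def using card.remove[OF finA A(3)] by simp
  \<comment> \<open>The classes modulo \<open>h\<close> that \<open>A\<close> meets are not all
    classes, and they have fewer than \<open>l div h\<close> gaps in total. The modulus
    \<open>l\<close> itself qualifies, without any gap.\<close>
  define P where "P = (\<lambda>h. 0 < h \<and> int h dvd l \<and> card (residue_set (int h) A) < h \<and>
    int (card (residue_set (int h) A)) * (l div int h) \<le> k - 1 + l div int h - 1)"
  have "P (nat l)" unfolding P_def using l resl cardA' kl by (auto simp: nat_less_iff zless_nat_eq_int_zless)
  define h0 where "h0 = (LEAST h. P h)"
  have Ph: "P h0" unfolding h0_def using \<open>P (nat l)\<close> by (rule LeastI)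
  have least: "h0 \<le> h'" if "P h'" for h' unfolding h0_def using that by (rule Least_le)
  define h where "h = int h0"
  define N where "N = l div h"
  define j where "j = int (card (residue_set h A))"
  have h: "0 < h" "h dvd l" "j < h" "j * N \<le> k - 1 + N - 1"
    using Ph unfolding P_def h_def N_def j_def by auto
  have lN: "l = N * h" unfolding N_def using h by simp
  have N: "0 < N" unfolding N_def using h l by (simp add: pos_imp_zdiv_pos_iff zdvd_imp_le)
  have finR: "finite (residue_set h A)" unfolding residue_set_def using finA by simp
  have j0: "0 < j" unfolding j_def using finR A by (auto simp: card_gt_0_iff residue_set_def)
  have j2: "2 \<le> j"
  proof (rule ccontr)
    assume "\<not> 2 \<le> j"
    then have "card (residue_set h A) = 1" using j0 unfolding j_def by linarith
    then obtain c where c: "residue_set h A = {c}" by (auto simp: card_Suc_eq)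
    have "0 mod h \<in> residue_set h A" unfolding residue_set_def using A by blast
    then have "c = 0" using c by simp
    then have "h dvd a" if "a \<in> A" for a using c that unfolding residue_set_def by auto
    moreover have "2 \<le> h" using h j0 by linarith
    ultimately show False using gcd by blast
  qed
  define q where "q = int (card (residue_set h D))"
  \<comment> \<open>Otherwise Mann's theorem yields a smaller divisor \<open>g\<close> of
    \<open>h\<close>. Its inequality, multiplied by \<open>N\<close> and combined with the one for
    \<open>h\<close>, gives \<open>P g\<close>, against minimality.\<close>
  have qcases: "q = h \<or> 2 * j - 1 \<le> q"
  proof (rule ccontr)
    assume *: "\<not> ?thesis"
    have "q \<le> h" unfolding q_def using card_residue_set_le[OF h(1), of D] h(1) by simp
    then have "card (residue_set h (difference_set A)) < nat h" "card (residue_set h (difference_set A)) + 2 \<le> 2 * card (residue_set h A)"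
      using * unfolding q_def j_def D_def by linarith+
    then obtain g where g: "0 < g" "g dvd h" "g < h" "card (residue_set g A) < nat g"
      "int (card (residue_set g A)) * (h div g) \<le> j + h div g - 2"
      unfolding j_def using few_difference_residue_set[OF h(1)] A(2) by blast
    have lg: "l div g = N * (h div g)" using lN g by (metis div_mult_swap)
    have "int (card (residue_set g A)) * (l div g) = N * (int (card (residue_set g A)) * (h div g))" unfolding lg by simp
    also have "\<dots> \<le> N * (j + h div g - 2)" using g N by (intro mult_left_mono) auto
    also have "\<dots> = j * N + l div g - 2 * N" unfolding lg by (simp add: algebra_simps)
    also have "\<dots> \<le> k - 1 + l div g - 1" using h N by linarith
    finally have "P (nat g)" unfolding P_def using g h by (auto intro: dvd_trans)
    then show False using least[of "nat g"] g unfolding h_def by linarith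
  qed
  define F where "F = (\<lambda>i. {a \<in> A - {l}. a mod h = i})"
  define J where "J = residue_set h A"
  have J_eq: "J = (\<lambda>a. a mod h) ` (A - {l})" unfolding J_def using resA[OF h(2)] unfolding residue_set_def by simp
  \<comment> \<open>Number of gaps in the class \<open>i\<close>. The element \<open>l\<close> is
    left out throughout because it repeats the residue 0.\<close>
  define e where "e = (\<lambda>i. N - int (card (F i)))"
  have finF: "finite (F i)" for i unfolding F_def using finA by simp
  have Fne: "F i \<noteq> {}" if "i \<in> J" for i using that unfolding J_eq F_def by auto
  have e0: "0 \<le> e i" if i: "i \<in> J" for i
  proof -
    obtain a where "i = a mod h" using i unfolding J_eq by auto
    then have "F i \<subseteq> {x \<in> {0..<l}. x mod h = a mod h}" unfolding F_def using bound by auto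
    then have "card (F i) \<le> card {x \<in> {0..<l}. x mod h = a mod h}" by (rule card_mono[OF finite_int_segment])
    then have "card (F i) \<le> nat N" unfolding N_def card_residue_class[OF h(1,2) l] .
    then show ?thesis unfolding e_def using N by linarith
  qed
  define E where "E = sum e J"
  have finJ: "finite J" unfolding J_def using finR .
  have cardJ: "int (card J) = j" unfolding J_def j_def ..
  have "card (A - {l}) = (\<Sum>i\<in>J. card (F i))"
    unfolding J_eq F_def using finA by (intro card_eq_sum_fibres) auto
  then have "(\<Sum>i\<in>J. int (card (F i))) = k - 1" using cardA' by (metis of_nat_sum)
  then have E: "E = j * N - (k - 1)" unfolding E_def e_def sum_subtractf using cardJ by simp
  have EN: "E \<le> N - 1" using E h by linarith
  have two: "e i + e i' \<le> E" if "i \<in> J" "i' \<in> J" "i \<noteq> i'" for i i'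
  proof -
    have "sum e {i, i'} \<le> sum e J" using that finJ e0 by (intro sum_mono2) auto
    then show ?thesis using that unfolding E_def by simp
  qed
  have pair: "\<exists>i\<in>J. \<exists>i'\<in>J. (i - i') mod h = c \<and> e i + e i' \<le> E" if c: "c \<in> residue_set h D" for c
  proof (cases "c = 0")
    case True
    \<comment> \<open>The class of 0 needs a pair \<open>(i, i)\<close>: of two distinct classes,
      the one with fewer gaps satisfies \<open>2 * e i \<le> E\<close>.\<close>
    have "2 \<le> card J" using j2 cardJ by linarith
    then obtain i i' where ii: "i \<in> J" "i' \<in> J" "i \<noteq> i'" by (auto simp: numeral_2_eq_2 card_le_Suc_iff)
    have "2 * e i \<le> E \<or> 2 * e i' \<le> E" using two[OF ii] by linarith
    then show ?thesis using ii True by force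
  next
    case False
    obtain a b where ab: "a \<in> A" "b \<in> A" "c = (a - b) mod h" using c unfolding residue_set_def D_def difference_set_def by auto
    have "a mod h \<in> J" "b mod h \<in> J" unfolding J_def residue_set_def using ab by auto
    moreover have "(a mod h - b mod h) mod h = c" using ab by (simp add: mod_diff_eq)
    moreover have "a mod h \<noteq> b mod h" using ab False by (auto simp: mod_eq_dvd_iff)
    ultimately show ?thesis using two by blast
  qed
  define G where "G = (\<lambda>c. {d \<in> D. d mod h = c})"
  have fib: "2 * N - E - 1 \<le> int (card (G c))" if c: "c \<in> residue_set h D" for c
  proof -
    obtain i i' where ii: "i \<in> J" "i' \<in> J" "(i - i') mod h = c" "e i + e i' \<le> E" using pair[OF c] by blast
    have "{a - b | a b. a \<in> F i \<and> b \<in> F i'} \<subseteq> G c"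
      unfolding G_def F_def D_def using ii(3) by (auto intro: diffsI simp: mod_diff_eq)
    moreover have "finite (G c)" unfolding G_def using finD by simp
    ultimately have "card {a - b | a b. a \<in> F i \<and> b \<in> F i'} \<le> card (G c)" by (rule card_mono[rotated])
    then show ?thesis using card_diff_ge[OF finF finF Fne[OF ii(1)] Fne[OF ii(2)]] ii(4) unfolding e_def by linarith
  qed
  have "card D = (\<Sum>c\<in>residue_set h D. card (G c))"
    unfolding residue_set_def G_def using finD by (rule card_eq_sum_fibres)
  then have "int (card D) = (\<Sum>c\<in>residue_set h D. int (card (G c)))" by simp
  also have "\<dots> \<ge> (\<Sum>c\<in>residue_set h D. 2 * N - E - 1)" by (intro sum_mono fib)
  finally have Dge: "q * (2 * N - E - 1) \<le> int (card D)" unfolding q_def by simp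
  \<comment> \<open>Pigeonhole: inside a class of \<open>N\<close> residues modulo \<open>l\<close>,
    the sets \<open>F i\<close> and \<open>F i' + z\<close> have together at least
    \<open>2 * N - E > N\<close> elements. They meet, so \<open>z\<close> is a difference modulo
    \<open>l\<close>; every difference class modulo \<open>h\<close> is full.\<close>
  have full: "int (card (residue_set l D)) \<ge> q * N"
  proof -
    have sub: "{z \<in> {0..<l}. z mod h \<in> residue_set h D} \<subseteq> residue_set l D"
    proof clarify
      fix z assume z: "z \<in> {0..<l}" "z mod h \<in> residue_set h D"
      obtain i i' where ii: "i \<in> J" "i' \<in> J" "(i - i') mod h = z mod h" "e i + e i' \<le> E" using pair[OF z(2)] by blast
      have imod: "i mod h = i" using ii(1) unfolding J_def residue_set_def by auto
      let ?C = "{x \<in> {0..<l}. x mod h = i mod h}"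
      let ?f = "\<lambda>b. (b + z) mod l"
      have 1: "F i \<subseteq> ?C" unfolding F_def imod using bound by auto
      have 2: "?f ` F i' \<subseteq> ?C"
      proof
        fix y assume "y \<in> ?f ` F i'"
        then obtain b where b: "b \<in> F i'" "y = (b + z) mod l" by auto
        have "y mod h = (b + z) mod h" using b h(2) by (simp add: mod_mod_cancel)
        also have "\<dots> = (b mod h + z mod h) mod h" by (simp add: mod_add_eq)
        also have "\<dots> = (i' + (i - i') mod h) mod h" using b ii(3) unfolding F_def by simp
        also have "\<dots> = i mod h" by (simp add: mod_add_right_eq)
        finally show "y \<in> ?C" using b l by simp
      qed
      have inj: "inj_on ?f (F i')"
      proof (rule inj_onI)
        fix x y assume *: "x \<in> F i'" "y \<in> F i'" "(x + z) mod l = (y + z) mod l"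
        then have "x mod l = y mod l" by (metis add_diff_cancel_right' mod_diff_left_eq)
        then show "x = y" using * bound unfolding F_def by auto
      qed
      have "F i \<inter> ?f ` F i' \<noteq> {}"
      proof
        assume "F i \<inter> ?f ` F i' = {}"
        then have "card (F i \<union> ?f ` F i') = card (F i) + card (F i')"
          using finF inj by (simp add: card_Un_disjoint card_image)
        moreover have "card (F i \<union> ?f ` F i') \<le> card ?C" using 1 2 by (intro card_mono[OF finite_int_segment] Un_least)
        ultimately show False using card_residue_class[OF h(1,2) l, of i] ii(4) EN N unfolding e_def N_def[symmetric] by linarith
      qed
      then obtain b where b: "b \<in> F i'" "(b + z) mod l \<in> F i" by auto
      have "(b + z) mod l - b \<in> D" unfolding D_def using b unfolding F_def by (auto intro: diffsI)
      moreover have "((b + z) mod l - b) mod l = z"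
      proof -
        have "((b + z) mod l - b) mod l = (b + z - b) mod l" by (rule mod_diff_left_eq)
        then show ?thesis using z by simp
      qed
      ultimately show "z \<in> residue_set l D" unfolding residue_set_def by (metis image_eqI)
    qed
    have "{z \<in> {0..<l}. z mod h \<in> residue_set h D} = (\<Union>c\<in>residue_set h D. {z \<in> {0..<l}. z mod h = c mod h})"
      unfolding residue_set_def by auto
    also have "card \<dots> = (\<Sum>c\<in>residue_set h D. card {z \<in> {0..<l}. z mod h = c mod h})"
    proof (intro card_UN_disjoint)
      show "finite (residue_set h D)" unfolding residue_set_def using finD by simp
      show "\<forall>i\<in>residue_set h D. \<forall>j\<in>residue_set h D. i \<noteq> j \<longrightarrow>
        {z \<in> {0..<l}. z mod h = i mod h} \<inter> {z \<in> {0..<l}. z mod h = j mod h} = {}"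
        unfolding residue_set_def by auto
      show "\<forall>c\<in>residue_set h D. finite {z \<in> {0..<l}. z mod h = c mod h}" by (intro ballI finite_int_segment)
    qed
    also have "\<dots> = (\<Sum>c\<in>residue_set h D. nat N)" unfolding N_def using card_residue_class[OF h(1,2) l] by simp
    finally have "int (card {z \<in> {0..<l}. z mod h \<in> residue_set h D}) = q * N" unfolding q_def using N by simp
    moreover have "finite (residue_set l D)" unfolding residue_set_def using finD by simp
    then have "card {z \<in> {0..<l}. z mod h \<in> residue_set h D} \<le> card (residue_set l D)" using sub by (rule card_mono)
    ultimately show ?thesis by linarith
  qed
  have DD: "int (card (residue_set l D)) + k \<le> int (card D)" "int (card D) + 7 \<le> 3 * k"
    using card_difference_set_ge_residue_set[OF A l] small unfolding D_def k_def by linarith+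
  have qN: "q * N \<le> 2 * k - 7" using full DD by linarith
  show False
  proof (cases "q = h")
    case True
    then have "l \<le> 2 * k - 7" using qN lN by (simp add: mult.commute)
    then show False using notdense unfolding k_def by simp
  next
    case False
    then have q: "2 * j - 1 \<le> q" using qcases by simp
    have "(2 * j - 1) * N \<le> 2 * k - 7" using mult_right_mono[OF q, of N] N qN by linarith
    then have E2: "2 * E \<le> N - 5" using E by (simp add: algebra_simps)
    have "(2 * j - 1) * (2 * N - E - 1) \<le> 3 * k - 7"
      using mult_right_mono[OF q, of "2 * N - E - 1"] E2 EN N Dge DD(2) by linarith
    also have "\<dots> = 3 * (j * N - E) - 4" using E by simp
    \<comment> \<open>With \<open>2 * E \<le> N - 5\<close> the left side is at least
      \<open>5 * (j - 2)\<close>, which exceeds \<open>2 * j - 5\<close> as soon as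
      \<open>j \<ge> 2\<close>.\<close>
    finally have "(j - 2) * (N - 2 * E) \<le> 2 * j - 5" by (simp add: algebra_simps)
    moreover have "(j - 2) * 5 \<le> (j - 2) * (N - 2 * E)" using j2 E2 by (intro mult_left_mono) auto
    ultimately have "(j - 2) * 5 \<le> 2 * j - 5" by (rule order_trans[rotated])
    then show False using j2 by presburger
  qed
qed

section \<open>Intervals and progressions in difference sets\<close>

lemma discrete_downward_crossing:
  fixes G :: "int \<Rightarrow> int"
  assumes step: "\<And>z. G z - 1 \<le> G (z + 1)" and ab: "a \<le> b" and v: "v \<le> G a" "G b < v"
  shows "\<exists>z. a \<le> z \<and> z < b \<and> G z = v \<and> G (z + 1) = v - 1"
  using ab v(2)
proof (induction b rule: int_ge_induct)
  case base
  then show ?case using v(1) by simp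
next
  case (step i)
  show ?case
  proof (cases "G i < v")
    case True
    then show ?thesis using step.IH by force
  next
    case False
    then have "G i = v" "G (i + 1) = v - 1" using assms(1)[of i] step.prems by linarith+
    then show ?thesis using step.hyps by force
  qed
qed

text \<open>The walk \<open>G\<close> counts the elements of \<open>A\<close> within distance less than \<open>e\<close> of the two ends \<open>0\<close>
  and \<open>l\<close>, minus \<open>e\<close>. A positive non-difference \<open>e\<close> is a down-step of \<open>G\<close> from a height of at least \<open>t + 2\<close>, and
  \<open>l - e\<close> is one from a height of at most \<open>1\<close>. If some non-difference is small, then \<open>G\<close> has to come down
  through the \<open>t\<close> levels in between, and these down-steps are neither; so there are too few
  non-differences for the difference set to be small.\<close>

lemma differences_contain_interval:
  assumes A: "A \<subseteq> {0..l}" "0 \<in> A" "l \<in> A"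
    and dense: "l + 3 \<le> 2 * int (card A)" and small: "card (difference_set A) + 4 \<le> 3 * card A"
    and d: "0 \<le> d" "d \<le> int (card A) - 1"
  shows "d \<in> difference_set A"
proof (rule ccontr)
  assume dD: "d \<notin> difference_set A"
  have finA: "finite A" using A finite_subset by auto
  have l0: "0 \<le> l" using A by auto
  define D where "D = difference_set A"
  have finD: "finite D" unfolding D_def using finA by (rule finite_difference_set)
  define k where "k = int (card A)"
  \<comment> \<open>Chosen so that the final height \<open>G (l + 1) = 2 * k - (l + 1)\<close> is
    \<open>t + 2\<close>; the density hypothesis says \<open>0 \<le> t\<close>.\<close>
  define t where "t = 2 * k - l - 3"
  define ind where "ind = (\<lambda>z. if z \<in> A then 1 else (0::int))"
  have ind01: "0 \<le> ind z" "ind z \<le> 1" for z unfolding ind_def by auto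
  define g where "g = (\<lambda>z. ind z + ind (l - z))"
  have g_sym: "g (l - z) = g z" for z unfolding g_def by simp
  define G where "G = (\<lambda>e. \<Sum>z\<in>{0..<e}. g z - 1)"
  have Gsuc: "G (z + 1) = G z + (g z - 1)" if "0 \<le> z" for z
  proof -
    have "{0..<z + 1} = insert z {0..<z}" using that by auto
    then show ?thesis unfolding G_def by simp
  qed
  have Gstep: "G z - 1 \<le> G (z + 1)" "G (z + 1) \<le> G z + 1" for z
  proof -
    show "G z - 1 \<le> G (z + 1)"
    proof (cases "0 \<le> z")
      case True then show ?thesis using Gsuc[of z] ind01[of z] ind01[of "l - z"] unfolding g_def by linarith
    next
      case False then show ?thesis unfolding G_def by simp
    qed
    show "G (z + 1) \<le> G z + 1"
    proof (cases "0 \<le> z")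
      case True then show ?thesis using Gsuc[of z] ind01[of z] ind01[of "l - z"] unfolding g_def by linarith
    next
      case False then show ?thesis unfolding G_def by simp
    qed
  qed
  have sumind: "(\<Sum>z\<in>{0..l}. ind z) = k"
  proof -
    have "(\<Sum>z\<in>{0..l}. ind z) = (\<Sum>z\<in>{0..l} \<inter> A. 1)" unfolding ind_def by (simp only: sum.inter_restrict finite_atLeastAtMost_int)
    moreover have "{0..l} \<inter> A = A" using A by auto
    ultimately show ?thesis unfolding k_def by simp
  qed
  have reflect: "(\<Sum>z\<in>{a..b}. f (a + b - z)) = (\<Sum>z\<in>{a..b}. f z)" for a b :: int and f :: "int \<Rightarrow> int"
    by (rule sum.reindex_bij_witness[of _ "\<lambda>z. a + b - z" "\<lambda>z. a + b - z"]) auto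
  have Gtot: "G (l + 1) = t + 2"
  proof -
    have "{0..<l + 1} = {0..l}" by auto
    then have "G (l + 1) = (\<Sum>z\<in>{0..l}. ind z) + (\<Sum>z\<in>{0..l}. ind (l - z)) - (l + 1)"
      unfolding G_def g_def using l0 by (simp add: sum.distrib sum_subtractf)
    moreover have "(\<Sum>z\<in>{0..l}. ind (l - z)) = k" using reflect[of ind 0 l] sumind by simp
    ultimately show ?thesis using sumind unfolding t_def by simp
  qed
  have Ganti: "G e + G (l + 1 - e) = t + 2" if e: "0 \<le> e" "e \<le> l + 1" for e
  proof -
    have "{0..<l + 1} = {0..<l + 1 - e} \<union> {l + 1 - e..<l + 1}" using e by auto
    then have "G (l + 1) = G (l + 1 - e) + (\<Sum>z\<in>{l + 1 - e..<l + 1}. g z - 1)"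
      unfolding G_def by (subst sum.union_disjoint[symmetric]) auto
    also have "(\<Sum>z\<in>{l + 1 - e..<l + 1}. g z - 1) = G e"
      unfolding G_def using g_sym
      by (intro sum.reindex_bij_witness[of _ "\<lambda>z. l - z" "\<lambda>z. l - z"]) auto
    finally show ?thesis using Gtot by simp
  qed
  have Glip: "G y - G x \<le> y - x" if "x \<le> y" for x y
    using that
  proof (induction y rule: int_ge_induct)
    case base then show ?case by simp
  next
    case (step i) then show ?case using Gstep(2)[of i] by simp
  qed
  define M where "M = {1..l} - D"
  have dM: "d \<in> M"
  proof -
    have "0 \<in> D" unfolding D_def using diffsI[OF A(2) A(2)] by simp
    then have "d \<noteq> 0" using dD D_def by blast
    moreover have "card A \<le> card {0..l}" using A by (intro card_mono) auto
    then have "d \<le> l" using d l0 by simp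
    ultimately show ?thesis using d dD unfolding M_def D_def by simp
  qed
  \<comment> \<open>After reflecting one of the two counts, \<open>z\<close> is paired with
    \<open>z + e\<close>. At most one of them is in \<open>A\<close> when \<open>e\<close> is no
    difference, so every term is at most 0.\<close>
  have Mlow: "G (l + 1 - e) \<le> 0" if e: "e \<in> M" for e
  proof -
    have "(\<Sum>z\<in>{0..l - e}. ind (l - z)) = (\<Sum>z\<in>{0..l - e}. ind (z + e))"
      using reflect[of "\<lambda>z. ind (z + e)" 0 "l - e"] by simp
    moreover have "{0..<l + 1 - e} = {0..l - e}" by auto
    ultimately have "G (l + 1 - e) = (\<Sum>z\<in>{0..l - e}. ind z + ind (z + e) - 1)"
      unfolding G_def g_def by (simp add: sum.distrib sum_subtractf)
    also have "\<dots> \<le> 0"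
    proof (intro sum_nonpos)
      fix z assume "z \<in> {0..l - e}"
      have "\<not> (z \<in> A \<and> z + e \<in> A)" using diffsI[of "z + e" A z] e unfolding M_def D_def by auto
      then show "ind z + ind (z + e) - 1 \<le> 0" unfolding ind_def by auto
    qed
    finally show ?thesis .
  qed
  have Mhigh: "t + 2 \<le> G e" if "e \<in> M" for e
    using Ganti[of e] Mlow[OF that] that unfolding M_def by auto
  \<comment> \<open>Here \<open>d < k\<close> enters: \<open>G\<close> rises by at most one per
    step, so if \<open>l < 2 * d\<close>, the rise of at least \<open>t + 2 = 2 * k - l - 1\<close>
    from \<open>l + 1 - d\<close> to \<open>d\<close> would force \<open>k \<le> d\<close>.\<close>
  have dl: "2 * d \<le> l"
  proof (rule ccontr)
    assume "\<not> 2 * d \<le> l"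
    then have "G d - G (l + 1 - d) \<le> d - (l + 1 - d)" by (intro Glip) simp
    then have "k \<le> d" using Ganti[of d] Mlow[OF dM] dM unfolding M_def t_def by auto
    then show False using d unfolding k_def by simp
  qed
  define Z where "Z = {z \<in> {0..l}. g z = 0}"
  have finZ: "finite Z" unfolding Z_def by (rule finite_subset[of _ "{0..l}"]) auto
  have Z: "Z \<subseteq> {0..l} - A" unfolding Z_def g_def ind_def by (auto split: if_splits)
  have M0: "g e = 0" if e: "e \<in> M" for e
  proof -
    have "e \<notin> A" using diffsI[of e A 0] A(2) e unfolding M_def D_def by auto
    moreover have "l - e \<notin> A" using diffsI[of l A "l - e"] A(3) e unfolding M_def D_def by auto
    ultimately show ?thesis unfolding g_def ind_def by simp
  qed
  define V where "V = (\<lambda>e. l - e) ` M"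
  define W where "W = {z \<in> Z. 2 \<le> G z \<and> G z \<le> t + 1}"
  have MZ: "M \<subseteq> Z" unfolding Z_def using M0 by (auto simp: M_def)
  have VZ: "V \<subseteq> Z" unfolding Z_def V_def using M0 g_sym by (auto simp: M_def)
  have Vlow: "G z \<le> 1" if "z \<in> V" for z
  proof -
    obtain e where e: "e \<in> M" "z = l - e" using \<open>z \<in> V\<close> unfolding V_def by auto
    have "G (z + 1) = G z + (g z - 1)" using e unfolding M_def by (intro Gsuc) auto
    moreover have "g z = 0" using M0 e g_sym by simp
    moreover have "z + 1 = l + 1 - e" using e by simp
    ultimately show ?thesis using Mlow[OF e(1)] by simp
  qed
  have t0: "0 \<le> t" unfolding t_def k_def using dense by simp
  have "{2..t + 1} \<subseteq> G ` W"
  proof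
    fix v assume v: "v \<in> {2..t + 1}"
    have "\<exists>z. d \<le> z \<and> z < l + 1 - d \<and> G z = v \<and> G (z + 1) = v - 1"
      using Gstep(1) dl v Mhigh[OF dM] Mlow[OF dM] by (intro discrete_downward_crossing) auto
    then obtain z where z: "d \<le> z" "z < l + 1 - d" "G z = v" "G (z + 1) = v - 1" by blast
    have "g z = 0" using z Gsuc[of z] d by simp
    then have "z \<in> W" unfolding W_def Z_def using z v d by auto
    then show "v \<in> G ` W" using z by blast
  qed
  moreover have finW: "finite W" unfolding W_def using finZ by simp
  ultimately have cW: "t \<le> int (card W)" using surj_card_le[of W "{2..t+1}" G] by simp
  have fin: "finite M" "finite V" unfolding V_def M_def by auto
  have cV: "card V = card M" unfolding V_def by (intro card_image inj_onI) simp
  have "M \<inter> V = {}" "(M \<union> V) \<inter> W = {}" using Mhigh Vlow t0 unfolding W_def by fastforce+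
  then have "card (M \<union> V \<union> W) = card M + card V + card W" using fin finW by (simp add: card_Un_disjoint)
  moreover have "M \<union> V \<union> W \<subseteq> {0..l} - A" using MZ VZ Z unfolding W_def by blast
  then have "card (M \<union> V \<union> W) \<le> card ({0..l} - A)" by (intro card_mono) auto
  moreover have "card ({0..l} - A) + card A = card {0..l}"
    using card_Diff_subset[OF finA A(1)] card_mono[OF finite_atLeastAtMost_int A(1)] by linarith
  ultimately have r: "2 * int (card M) + t \<le> l + 1 - k" using cW cV l0 unfolding k_def by simp
  let ?P = "{1..l} - M"
  have P: "?P \<subseteq> D" unfolding M_def by auto
  have N: "uminus ` ?P \<subseteq> D"
  proof
    fix x assume "x \<in> uminus ` ?P"
    then have "- x \<in> D" using P by auto
    then obtain a b where "a \<in> A" "b \<in> A" "- x = a - b" unfolding D_def difference_set_def by auto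
    then have "x = b - a" by simp
    then show "x \<in> D" unfolding D_def using diffsI \<open>a \<in> A\<close> \<open>b \<in> A\<close> by blast
  qed
  have "M \<subseteq> {1..l}" unfolding M_def by auto
  then have cP: "int (card ?P) = l - int (card M)" using l0 fin card_mono[of "{1..l}" M] by (simp add: card_Diff_subset)
  have "card (uminus ` ?P) = card ?P" by (intro card_image inj_onI) simp
  moreover have "card (?P \<union> uminus ` ?P) = card ?P + card (uminus ` ?P)"
    by (intro card_Un_disjoint) auto
  moreover have "card (insert 0 (?P \<union> uminus ` ?P)) = card (?P \<union> uminus ` ?P) + 1"
    by (subst card_insert_disjoint) auto
  moreover have "0 \<in> D" unfolding D_def using diffsI[OF A(2) A(2)] by simp
  then have "card (insert 0 (?P \<union> uminus ` ?P)) \<le> card D" using P N finD by (intro card_mono) auto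
  \<comment> \<open>By \<open>r\<close>, \<open>2 * |M| \<le> l + 1 - k - t\<close>, so there are at
    least \<open>2 * (l - |M|) + 1 \<ge> 3 * k - 3\<close> differences.\<close>
  ultimately have "2 * int (card ?P) + 1 \<le> int (card D)" by linarith
  then show False using r small cP unfolding D_def k_def t_def by linarith
qed

lemma difference_set_image: "difference_set (f ` A) = {f a - f b | a b. a \<in> A \<and> b \<in> A}"
  unfolding difference_set_def by blast

lemma difference_set_translate: "difference_set ((\<lambda>x. x - c) ` A) = difference_set A"
  unfolding difference_set_image by (simp add: difference_set_def)

lemma difference_set_scale: "difference_set ((\<lambda>x. g * x) ` A) = (\<lambda>x. g * x) ` difference_set A"
  unfolding difference_set_image right_diff_distrib[symmetric] by (auto simp: difference_set_def)

text \<open>Moving the minimum to 0 and dividing by the gcd \<open>g\<close> gives a set from 0 to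
  \<open>l\<close> without common factor, which is dense by the first result and then covered by the
  second. The 7 is the allowance of the density bound.\<close>

lemma differences_contain_progression:
  assumes finA: "finite A" and small: "card (difference_set A) + 7 \<le> 3 * card A"
  obtains g where "0 < g" "\<And>e. \<bar>e\<bar> \<le> int (card A) - 1 \<Longrightarrow> g * e \<in> difference_set A"
proof -
  have k2: "2 \<le> card A" using small by linarith
  then have A0: "A \<noteq> {}" by auto
  define B where "B = (\<lambda>x. x - Min A) ` A"
  have finB: "finite B" unfolding B_def using finA by simp
  have cB: "card B = card A" unfolding B_def by (intro card_image inj_onI) simp
  have 0: "0 \<in> B" unfolding B_def using Min_in[OF finA A0] by force
  have Bpos: "0 \<le> b" if "b \<in> B" for b using that finA unfolding B_def by auto
  define g where "g = Gcd B"
  have "B \<noteq> {0}" using cB k2 by auto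
  then obtain b0 where b0: "b0 \<in> B" "b0 \<noteq> 0" using 0 by auto
  have g0: "0 < g"
  proof -
    have "g dvd b0" unfolding g_def using b0(1) by (rule Gcd_dvd)
    then have "g \<noteq> 0" using b0 by auto
    moreover have "0 \<le> g" unfolding g_def by simp
    ultimately show ?thesis by simp
  qed
  define C where "C = (\<lambda>x. x div g) ` B"
  have gB: "g * (b div g) = b" if "b \<in> B" for b using that g_def Gcd_dvd[of b B] by simp
  have BC: "B = (\<lambda>x. g * x) ` C" unfolding C_def by (simp add: image_image gB cong: image_cong_simp)
  have cC: "card C = card A" using cB BC g0 by (metis card_image inj_onI mult_cancel_left less_irrefl)
  have finC: "finite C" unfolding C_def using finB by simp
  have 0: "0 \<in> C" unfolding C_def using 0 by force
  have Cpos: "0 \<le> c" if "c \<in> C" for c using that Bpos g0 unfolding C_def by (auto simp: pos_imp_zdiv_nonneg_iff)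
  define l where "l = Max C"
  have C: "C \<subseteq> {0..l}" unfolding l_def using Cpos finC by auto
  have lC: "l \<in> C" unfolding l_def using finC 0 by (intro Max_in) auto
  have l: "0 < l"
  proof (rule ccontr)
    assume "\<not> 0 < l"
    then have "C \<subseteq> {0}" using C by auto
    then have "card C \<le> 1" using card_mono[of "{0}" C] by simp
    then show False using cC k2 by simp
  qed
  have gcd: "\<exists>a\<in>C. \<not> h dvd a" if "2 \<le> h" for h
  proof (rule ccontr)
    assume "\<not> ?thesis"
    then have "g * h dvd b" if "b \<in> B" for b using that unfolding BC by auto
    then have "g * h dvd g" unfolding g_def[symmetric] using g_def by (metis Gcd_greatest)
    then have "g * h \<le> g" using g0 by (intro zdvd_imp_le)
    then show False using g0 that by simp
  qed
  have DA: "difference_set A = (\<lambda>x. g * x) ` difference_set C"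
    using difference_set_translate[of "Min A" A] difference_set_scale[of g C] unfolding B_def[symmetric] BC by simp
  have "inj_on (\<lambda>x. g * x) (difference_set C)" using g0 by (intro inj_onI) simp
  then have small: "card (difference_set C) + 7 \<le> 3 * card C" using small cC unfolding DA by (simp add: card_image)
  have dense: "l + 7 \<le> 2 * int (card C)"
    using small_differences_imp_dense[OF C 0 lC l gcd small] .
  have "g * e \<in> difference_set A" if e: "\<bar>e\<bar> \<le> int (card A) - 1" for e
  proof -
    have "\<bar>e\<bar> \<in> difference_set C"
      using differences_contain_interval[OF C 0 lC, of "\<bar>e\<bar>"] dense small e cC by simp
    then obtain a b where "a \<in> C" "b \<in> C" "\<bar>e\<bar> = a - b" unfolding difference_set_def by auto
    then have "e = a - b \<or> e = b - a" by linarith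
    then have "e \<in> difference_set C" using diffsI \<open>a \<in> C\<close> \<open>b \<in> C\<close> by blast
    then show ?thesis unfolding DA by blast
  qed
  then show ?thesis using that g0 by blast
qed

section \<open>Sum-free sets modulo a prime\<close>

lemma dilate_mod_facts:
  assumes p: "prime p" and m: "m \<in> {1..p-1}" and A: "A \<subseteq> {0..<p}"
  shows "inj_on (\<lambda>x. (m * x) mod p) A" "card (dilate_mod p m A) = card A" "dilate_mod p m A \<subseteq> {0..<p}"
proof -
  have p1: "1 < p" using p by (rule prime_gt_1_nat)
  have "\<not> p dvd m" using m p1 by (auto dest: dvd_imp_le)
  then have cop: "coprime m p" using prime_imp_coprime[OF p] coprime_commute by blast
  show "inj_on (\<lambda>x. (m * x) mod p) A"
  proof (rule inj_onI)
    fix x y assume *: "x \<in> A" "y \<in> A" "(m * x) mod p = (m * y) mod p"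
    then have "[x = y] (mod p)" using cop cong_mult_lcancel_nat[of m p x y] unfolding cong_def by simp
    moreover have "x < p" "y < p" using * A by auto
    ultimately show "x = y" unfolding cong_def by simp
  qed
  then show "card (dilate_mod p m A) = card A" unfolding dilate_mod_def by (rule card_image)
  show "dilate_mod p m A \<subseteq> {0..<p}" unfolding dilate_mod_def using p1 by auto
qed

lemma sum_free_dilate_mod:
  assumes p: "prime p" and m: "m \<in> {1..p-1}" and A: "A \<subseteq> {0..<p}" and sf: "sum_free_mod p A"
  shows "sum_free_mod p (dilate_mod p m A)"
  unfolding sum_free_mod_def
proof (intro ballI)
  fix x y z assume "x \<in> dilate_mod p m A" "y \<in> dilate_mod p m A" "z \<in> dilate_mod p m A"
  then obtain a b c where abc: "a \<in> A" "b \<in> A" "c \<in> A" "x = (m * a) mod p" "y = (m * b) mod p" "z = (m * c) mod p"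
    unfolding dilate_mod_def by auto
  have p1: "1 < p" using p by (rule prime_gt_1_nat)
  show "(x + y) mod p \<noteq> z"
  proof
    assume "(x + y) mod p = z"
    then have eq: "(m * ((a + b) mod p)) mod p = (m * c) mod p"
      unfolding abc by (simp add: mod_add_eq mod_mult_right_eq distrib_left)
    have "inj_on (\<lambda>x. (m * x) mod p) {0..<p}" using dilate_mod_facts(1)[OF p m] by simp
    moreover have "(a + b) mod p \<in> {0..<p}" "c \<in> {0..<p}" using p1 A abc by auto
    ultimately have "(a + b) mod p = c" using eq by (auto dest: inj_onD)
    then show False using sf abc unfolding sum_free_mod_def by blast
  qed
qed

lemma dilate_mod_dilate_mod: "dilate_mod p m (dilate_mod p r A) = dilate_mod p ((m * r) mod p) A"
  unfolding dilate_mod_def by (auto simp: image_image mod_mult_right_eq mod_mult_left_eq mult.assoc)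

lemma mult_mod_prime_nonzero:
  fixes p m r :: nat
  assumes p: "prime p" and "m \<in> {1..p-1}" "r \<in> {1..p-1}"
  shows "(m * r) mod p \<in> {1..p-1}"
proof -
  have p1: "1 < p" using p by (rule prime_gt_1_nat)
  have "\<not> p dvd m" "\<not> p dvd r" using assms p1 by (auto dest: dvd_imp_le)
  then have "\<not> p dvd m * r" using p by (simp add: prime_dvd_mult_iff)
  then have "0 < (m * r) mod p" by (simp add: mod_greater_zero_iff_not_dvd)
  moreover have "(m * r) mod p < p" using p1 by simp
  ultimately show ?thesis by auto
qed

text \<open>One pass, for the arc of length \<open>h\<close> starting at \<open>u\<close>. Since
  \<open>2 * (h - 1) < p\<close>, distinct differences of the arc stay distinct modulo
  \<open>p\<close> and inject into the complement of \<open>A\<close>, which by the density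
  hypothesis has at most \<open>3 * k - 7\<close> elements.\<close>

lemma sum_free_dense_arc:
  assumes p: "prime p" and A: "A \<subseteq> {0..<p}" and sf: "sum_free_mod p A"
    and h: "2 * h \<le> int p + 1"
    and dense: "p + 7 \<le> card A + 3 * card {x \<in> A. (int x - u) mod int p < h}" (is "_ \<le> _ + 3 * ?k")
  shows "\<exists>m\<in>{1..p-1}. dilate_mod p m A \<subseteq> {?k..p - ?k}"
proof -
  have p1: "1 < p" using p by (rule prime_gt_1_nat)
  have finA: "finite A" using A finite_subset by auto
  define A1 where "A1 = {x \<in> A. (int x - u) mod int p < h}"
  define f where "f = (\<lambda>x. (int x - u) mod int p)"
  define B where "B = f ` A1"
  have fA1: "0 \<le> f x" "f x < h" if "x \<in> A1" for x using that p1 unfolding A1_def f_def by auto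
  have finA1: "finite A1" unfolding A1_def using finA by simp
  have fdiff: "(f x - f y) mod int p = (int x - int y) mod int p" for x y
    unfolding f_def by (simp add: mod_diff_eq)
  have inj: "inj_on f A1"
  proof (rule inj_onI)
    fix x y assume *: "x \<in> A1" "y \<in> A1" "f x = f y"
    then have "(int x - int y) mod int p = 0" using fdiff[of x y] by simp
    then have "int x mod int p = int y mod int p" by (simp add: mod_eq_dvd_iff dvd_eq_mod_eq_0)
    moreover have "x < p" "y < p" using * A unfolding A1_def by auto
    ultimately show "x = y" by simp
  qed
  have cB: "card B = ?k" unfolding B_def using inj card_image[of f A1] A1_def by simp
  have finB: "finite B" unfolding B_def using finA1 by simp
  have notA: "nat (d mod int p) \<notin> A" if d: "d \<in> difference_set B" for d
  proof
    assume z: "nat (d mod int p) \<in> A"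
    obtain x y where xy: "x \<in> A1" "y \<in> A1" "d = f x - f y" using d unfolding difference_set_def B_def by auto
    have "int (nat (d mod int p)) = d mod int p" using p1 by simp
    then have "(int (nat (d mod int p)) + int y) mod int p = (d + int y) mod int p" by (simp add: mod_add_left_eq)
    also have "\<dots> = ((int x - int y) mod int p + int y) mod int p"
      unfolding xy(3) fdiff[symmetric] by (simp add: mod_add_left_eq)
    also have "\<dots> = int x mod int p" by (simp add: mod_add_left_eq)
    also have "\<dots> = int x" using xy A unfolding A1_def by auto
    finally have "int ((nat (d mod int p) + y) mod p) = int x" by (simp add: zmod_int)
    then have "(nat (d mod int p) + y) mod p = x" by linarith
    then show False using sf z xy unfolding sum_free_mod_def A1_def by blast
  qed
  have dbound: "\<bar>d\<bar> < h" if d: "d \<in> difference_set B" for d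
  proof -
    obtain x y where xy: "x \<in> A1" "y \<in> A1" "d = f x - f y" using d unfolding difference_set_def B_def by auto
    then show ?thesis using fA1[of x] fA1[of y] by linarith
  qed
  have "card (difference_set B) \<le> card ({0..<p} - A)"
  proof (rule card_inj_on_le)
    show "inj_on (\<lambda>d. nat (d mod int p)) (difference_set B)"
    proof (rule inj_onI)
      fix d d' assume *: "d \<in> difference_set B" "d' \<in> difference_set B" "nat (d mod int p) = nat (d' mod int p)"
      then have "d mod int p = d' mod int p" using p1 by (simp add: nat_eq_iff)
      then have "int p dvd d - d'" by (simp add: mod_eq_dvd_iff)
      moreover have "\<bar>d - d'\<bar> < int p" using dbound[OF *(1)] dbound[OF *(2)] h by linarith
      ultimately show "d = d'" using dvd_imp_le_int[of "d - d'" "int p"] by fastforce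
    qed
    show "(\<lambda>d. nat (d mod int p)) ` difference_set B \<subseteq> {0..<p} - A"
      using notA p1 by (auto simp: nat_less_iff)
  qed simp
  also have "\<dots> = p - card A" using A finA by (simp add: card_Diff_subset)
  finally have small: "card (difference_set B) + 7 \<le> 3 * card B"
    using dense cB card_mono[OF _ A] by simp
  then obtain g where g: "0 < g" "\<And>e. \<bar>e\<bar> \<le> int (card B) - 1 \<Longrightarrow> g * e \<in> difference_set B"
    using differences_contain_progression[OF finB] by blast
  have k2: "2 \<le> card B" using small by linarith
  have "g \<in> difference_set B" using g(2)[of 1] k2 by simp
  then have gp: "g < int p" using dbound[of g] h g(1) by linarith
  have "\<not> p dvd nat g" using g(1) gp by (auto dest: dvd_imp_le)
  then have "coprime (nat g) p" using prime_imp_coprime[OF p] coprime_commute by blast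
  then obtain m0 where m0: "[nat g * m0 = Suc 0] (mod p)" using cong_solve_coprime_nat by blast
  define m where "m = m0 mod p"
  have gm: "(nat g * m) mod p = 1" using m0 p1 unfolding m_def cong_def by (simp add: mod_mult_right_eq)
  have m: "m \<in> {1..p-1}"
  proof -
    have "m \<noteq> 0" using gm by (intro notI) simp
    moreover have "m < p" unfolding m_def using p1 by simp
    ultimately show ?thesis by auto
  qed
  \<comment> \<open>\<open>m\<close> inverts \<open>g\<close> modulo \<open>p\<close>. If
    \<open>m * a\<close> were congruent to such an \<open>e\<close>, then \<open>a\<close> would be
    congruent to \<open>g * e\<close>, a difference of the arc and hence outside
    \<open>A\<close>.\<close>
  have notsmall: "\<not> \<bar>e\<bar> \<le> int (card B) - 1" if e: "(int (m * a) - e) mod int p = 0" and a: "a \<in> A" for e a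
  proof
    assume "\<bar>e\<bar> \<le> int (card B) - 1"
    then have "g * e \<in> difference_set B" by (rule g(2))
    then have na: "nat ((g * e) mod int p) \<notin> A" by (rule notA)
    have "int p dvd int (m * a) - e" using e by auto
    then have "int p dvd g * (int (m * a) - e)" by simp
    then have "(g * e) mod int p = (g * int (m * a)) mod int p"
      by (metis mod_eq_dvd_iff right_diff_distrib)
    also have "\<dots> = int ((nat g * m * a) mod p)" using g(1) by (simp add: zmod_int mult.assoc)
    also have "(nat g * m * a) mod p = ((nat g * m) mod p * a) mod p" by (simp add: mod_mult_left_eq)
    also have "\<dots> = a" using gm a A by auto
    finally show False using na a by simp
  qed
  have "c \<in> {?k..p - ?k}" if c: "c \<in> dilate_mod p m A" for c
  proof -
    obtain a where a: "a \<in> A" "c = (m * a) mod p" using c unfolding dilate_mod_def by auto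
    have cp: "c < p" using a p1 by simp
    have c1: "(int (m * a) - int c) mod int p = 0" unfolding a(2) by (simp add: zmod_int mod_diff_right_eq)
    have c2: "(int (m * a) - (int c - int p)) mod int p = 0"
    proof -
      have "int (m * a) - (int c - int p) = (int (m * a) - int c) + int p" by simp
      then show ?thesis using c1 by (simp only: mod_add_self2)
    qed
    \<comment> \<open>The representatives \<open>c\<close> and \<open>c - p\<close> give the lower
      and the upper end.\<close>
    have "?k \<le> c" "c + ?k \<le> p" using notsmall[OF c1 a(1)] notsmall[OF c2 a(1)] cp cB by linarith+
    then show ?thesis by auto
  qed
  then show ?thesis using m by blast
qed

section \<open>Fourier coefficients of sum-free sets\<close>

lemma sum_cis_residues:
  fixes p :: nat and t :: int
  assumes p: "0 < p"
  shows "(\<Sum>r<p. cis (2 * pi * real r * real_of_int t / real p)) = (if int p dvd t then of_nat p else 0)"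
proof -
  define w where "w = cis (2 * pi * real_of_int t / real p)"
  have pw: "w ^ r = cis (2 * pi * real r * real_of_int t / real p)" for r
    unfolding w_def DeMoivre by (simp add: algebra_simps)
  show ?thesis
  proof (cases "int p dvd t")
    case True
    then obtain s where s: "t = int p * s" by (elim dvdE)
    have "2 * pi * real_of_int t / real p = 2 * pi * real_of_int s" unfolding s using p by simp
    then have "w = 1" unfolding w_def by simp
    then show ?thesis using True pw[symmetric] by simp
  next
    case False
    have "w \<noteq> 1"
    proof
      assume "w = 1"
      then have "cos (2 * pi * real_of_int t / real p) = 1" unfolding w_def by (simp add: complex_eq_iff)
      then obtain x :: int where "2 * pi * real_of_int t / real p = of_int x * 2 * pi"
        using cos_one_2pi_int by blast
      then have "2 * pi * real_of_int t = 2 * pi * (real_of_int x * real p)" using p by (simp add: field_simps)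
      then have "real_of_int t = real_of_int x * real p" by simp
      then have "t = x * int p" by (metis of_int_eq_iff of_int_mult of_int_of_nat_eq)
      then show False using False by simp
    qed
    moreover have "w ^ p = 1"
    proof -
      have "2 * pi * real p * real_of_int t / real p = 2 * pi * real_of_int t" using p by simp
      then show ?thesis unfolding pw by simp
    qed
    ultimately show ?thesis using False pw[symmetric] geometric_sum[of w p] by simp
  qed
qed

lemma card_sum_free_mod_less:
  assumes "0 < p" "A \<subseteq> {0..<p}" "sum_free_mod p A"
  shows "card A < p"
proof -
  have "0 \<notin> A" using assms unfolding sum_free_mod_def by force
  then have "A \<subset> {0..<p}" using assms by force
  then have "card A < card {0..<p}" by (intro psubset_card_mono) auto
  then show ?thesis by simp
qed

text \<open>The sum of \<open>S r * |S r|^2\<close> over all \<open>r\<close> counts solutions of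
  \<open>x + y = z\<close> and vanishes. Removing \<open>r = 0\<close>, which contributes
  \<open>n^3\<close>, and dividing by the remaining Parseval mass \<open>n (p - n)\<close> shows
  that the weighted average of \<open>Re (S r)\<close> is \<open>- n^2 / (p - n)\<close>.\<close>

lemma sum_free_large_negative_coefficient:
  assumes p: "prime p" and A: "A \<subseteq> {0..<p}" and sf: "sum_free_mod p A" and A0: "A \<noteq> {}"
  shows "\<exists>r\<in>{1..p-1}. (\<Sum>a\<in>A. cos (2 * pi * real r * real a / real p)) \<le> - (real (card A) ^ 2) / (real p - real (card A))"
proof -
  have p1: "1 < p" using p by (rule prime_gt_1_nat)
  have p0: "0 < p" using p1 by simp
  have finA: "finite A" using A finite_subset by auto
  define n where "n = real (card A)"
  define S where "S = (\<lambda>r::nat. \<Sum>a\<in>A. cis (2 * pi * real r * real a / real p))"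
  have prod2: "S r * cnj (S r) = (\<Sum>x\<in>A. \<Sum>z\<in>A. cis (2 * pi * real r * real_of_int (int x - int z) / real p))" for r
    unfolding S_def by (simp add: sum_product cis_cnj cis_mult diff_divide_distrib algebra_simps)
  have prod3: "S r * (S r * cnj (S r)) =
     (\<Sum>y\<in>A. \<Sum>x\<in>A. \<Sum>z\<in>A. cis (2 * pi * real r * real_of_int (int y + int x - int z) / real p))" for r
    unfolding prod2 unfolding S_def sum_distrib_right
    by (intro sum.cong refl) (simp add: sum_distrib_left cis_mult diff_divide_distrib add_divide_distrib
      right_diff_distrib distrib_left add_diff_eq)
  have swap2: "(\<Sum>r<p. \<Sum>x\<in>A. \<Sum>z\<in>A. g r x z) = (\<Sum>x\<in>A. \<Sum>z\<in>A. \<Sum>r<p. g r x z)"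
    for g :: "nat \<Rightarrow> nat \<Rightarrow> nat \<Rightarrow> complex"
  proof -
    have "(\<Sum>r<p. \<Sum>x\<in>A. \<Sum>z\<in>A. g r x z) = (\<Sum>x\<in>A. \<Sum>r<p. \<Sum>z\<in>A. g r x z)" by (rule sum.swap)
    also have "\<dots> = (\<Sum>x\<in>A. \<Sum>z\<in>A. \<Sum>r<p. g r x z)" by (rule sum.cong[OF refl], rule sum.swap)
    finally show ?thesis .
  qed
  have swap3: "(\<Sum>r<p. \<Sum>y\<in>A. \<Sum>x\<in>A. \<Sum>z\<in>A. g r y x z) = (\<Sum>y\<in>A. \<Sum>x\<in>A. \<Sum>z\<in>A. \<Sum>r<p. g r y x z)"
    for g :: "nat \<Rightarrow> nat \<Rightarrow> nat \<Rightarrow> nat \<Rightarrow> complex"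
  proof -
    have "(\<Sum>r<p. \<Sum>y\<in>A. \<Sum>x\<in>A. \<Sum>z\<in>A. g r y x z) = (\<Sum>y\<in>A. \<Sum>r<p. \<Sum>x\<in>A. \<Sum>z\<in>A. g r y x z)" by (rule sum.swap)
    also have "\<dots> = (\<Sum>y\<in>A. \<Sum>x\<in>A. \<Sum>z\<in>A. \<Sum>r<p. g r y x z)" by (rule sum.cong[OF refl], rule swap2)
    finally show ?thesis .
  qed
  have inj: "int p dvd int x - int z \<longleftrightarrow> x = z" if "x \<in> A" "z \<in> A" for x z
  proof -
    have "x < p" "z < p" using that A by auto
    then have "int x mod int p = int x" "int z mod int p = int z" by auto
    then show ?thesis by (metis mod_eq_dvd_iff of_nat_eq_iff)
  qed
  have "(\<Sum>r<p. S r * cnj (S r)) = (\<Sum>x\<in>A. \<Sum>z\<in>A. \<Sum>r<p. cis (2 * pi * real r * real_of_int (int x - int z) / real p))"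
    unfolding prod2 by (rule swap2)
  also have "\<dots> = (\<Sum>x\<in>A. \<Sum>z\<in>A. if x = z then of_nat p else 0)"
    unfolding sum_cis_residues[OF p0] by (intro sum.cong refl) (simp add: inj)
  also have "\<dots> = of_nat (card A * p)" using finA by simp
  finally have "(\<Sum>r<p. S r * cnj (S r)) = of_nat (card A * p)" .
  moreover have nS: "S r * cnj (S r) = of_real ((cmod (S r))\<^sup>2)" for r by (simp only: complex_norm_square)
  ultimately have "complex_of_real (\<Sum>r<p. (cmod (S r))\<^sup>2) = complex_of_real (n * real p)"
    unfolding n_def by simp
  then have parseval: "(\<Sum>r<p. (cmod (S r))\<^sup>2) = n * real p" using of_real_eq_iff by blast
  have nodvd: "\<not> int p dvd int x + int y - int z" if "x \<in> A" "y \<in> A" "z \<in> A" for x y z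
  proof
    assume "int p dvd int x + int y - int z"
    then have "(int x + int y) mod int p = int z mod int p" by (simp add: mod_eq_dvd_iff)
    also have "\<dots> = int z" using that A by auto
    finally have "int ((x + y) mod p) = int z" by (simp add: zmod_int)
    then show False using sf that unfolding sum_free_mod_def by auto
  qed
  have "(\<Sum>r<p. S r * (S r * cnj (S r))) =
    (\<Sum>y\<in>A. \<Sum>x\<in>A. \<Sum>z\<in>A. \<Sum>r<p. cis (2 * pi * real r * real_of_int (int y + int x - int z) / real p))"
    unfolding prod3
    by (rule swap3)
  also have "\<dots> = 0"
    unfolding sum_cis_residues[OF p0] by (intro sum.neutral ballI) (simp add: nodvd)
  finally have "(\<Sum>r<p. S r * (S r * cnj (S r))) = 0" .
  then have "Re (\<Sum>r<p. S r * of_real ((cmod (S r))\<^sup>2)) = 0" unfolding nS by simp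
  then have triple: "(\<Sum>r<p. Re (S r) * (cmod (S r))\<^sup>2) = 0" by simp
  have split: "(\<Sum>r<p. f r) = f 0 + (\<Sum>r\<in>{1..p-1}. f r)" for f :: "nat \<Rightarrow> real"
  proof -
    have "{..<p} = insert 0 {1..p-1}" using p1 by auto
    then show ?thesis by simp
  qed
  have S0: "S 0 = of_real n" unfolding S_def n_def by simp
  have n0: "0 < n" unfolding n_def using A0 finA by (simp add: card_gt_0_iff)
  have c0: "(cmod (S 0))\<^sup>2 = n\<^sup>2" "Re (S 0) = n" unfolding S0 using n0 by auto
  have P: "(\<Sum>r\<in>{1..p-1}. (cmod (S r))\<^sup>2) = n * (real p - n)"
    using parseval split[of "\<lambda>r. (cmod (S r))\<^sup>2"] c0 by (simp add: power2_eq_square algebra_simps)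
  have Tr: "(\<Sum>r\<in>{1..p-1}. Re (S r) * (cmod (S r))\<^sup>2) = - (n ^ 3)"
    using triple split[of "\<lambda>r. Re (S r) * (cmod (S r))\<^sup>2"] c0 by (simp add: power3_eq_cube power2_eq_square algebra_simps)
  have np: "n < real p" using card_sum_free_mod_less[OF p0 A sf] unfolding n_def by simp
  define \<theta> where "\<theta> = n\<^sup>2 / (real p - n)"
  have "\<exists>r\<in>{1..p-1}. Re (S r) \<le> - \<theta>"
  proof (rule ccontr)
    assume "\<not> ?thesis"
    then have gt: "Re (S r) > - \<theta>" if "r \<in> {1..p-1}" for r using that by force
    \<comment> \<open>The \<open>q r\<close> sum to 0. Were every \<open>Re (S r)\<close> above the
      average, all weights \<open>|S r|^2\<close> would vanish, against Parseval.\<close>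
    define q where "q = (\<lambda>r. (Re (S r) + \<theta>) * (cmod (S r))\<^sup>2)"
    have "(\<Sum>r\<in>{1..p-1}. q r) = - (n ^ 3) + \<theta> * (n * (real p - n))"
      unfolding q_def using P Tr by (simp add: distrib_right sum.distrib sum_distrib_left[symmetric])
    also have "\<dots> = 0" unfolding \<theta>_def using np by (simp add: power2_eq_square power3_eq_cube)
    finally have q0: "(\<Sum>r\<in>{1..p-1}. q r) = 0" .
    have qn: "0 \<le> q r" if "r \<in> {1..p-1}" for r using gt[OF that] unfolding q_def by simp
    have "q r = 0" if "r \<in> {1..p-1}" for r
      using sum_nonneg_eq_0_iff[of "{1..p-1}" q] q0 qn that by blast
    then have "(cmod (S r))\<^sup>2 = 0" if "r \<in> {1..p-1}" for r
      using gt[OF that] that unfolding q_def by fastforce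
    then have "(\<Sum>r\<in>{1..p-1}. (cmod (S r))\<^sup>2) = 0" by simp
    then show False using P n0 np by simp
  qed
  moreover have "Re (S r) = (\<Sum>a\<in>A. cos (2 * pi * real r * real a / real p))" for r
    unfolding S_def by simp
  ultimately obtain r where r: "r \<in> {1..p-1}" "(\<Sum>a\<in>A. cos (2 * pi * real r * real a / real p)) \<le> - \<theta>"
    by auto
  moreover have "- \<theta> = - (real (card A) ^ 2) / (real p - real (card A))" unfolding \<theta>_def n_def by simp
  ultimately show ?thesis by auto
qed

lemma cos_sum_dilate_mod:
  assumes p: "prime p" and r: "r \<in> {1..p-1}" and A: "A \<subseteq> {0..<p}"
  shows "(\<Sum>b\<in>dilate_mod p r A. cos (2 * pi * real b / real p)) = (\<Sum>a\<in>A. cos (2 * pi * real r * real a / real p))"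
proof -
  have p1: "1 < p" using p by (rule prime_gt_1_nat)
  have "cos (2 * pi * real ((r * a) mod p) / real p) = cos (2 * pi * real r * real a / real p)" for a
  proof -
    have e: "real ((r * a) mod p) = real r * real a - real p * real ((r * a) div p)"
      by (metis minus_mult_div_eq_mod of_nat_diff of_nat_mult times_div_less_eq_dividend)
    have "2 * pi * real ((r * a) mod p) / real p = 2 * pi * real r * real a / real p - 2 * pi * real ((r * a) div p)"
      unfolding e using p1 by (simp only: right_diff_distrib diff_divide_distrib) simp
    then show ?thesis by (simp add: cos_diff sin_integer_2pi cos_integer_2pi)
  qed
  then show ?thesis
    unfolding dilate_mod_def using dilate_mod_facts(1)[OF p r A] by (simp add: sum.reindex)
qed

section \<open>Cosine sums and arcs\<close>

text \<open>Summation by parts expresses the cosine sum through the excess \<open>\<tau> y\<close> of the half circle starting after \<open>y/2\<close> over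
  its complement. The excess is at most \<open>M\<close>, and the excesses
  of the mirror images for \<open>y\<close> and \<open>p - 1 - y\<close> add up to at most twice the size of their intersection.\<close>

lemma sum_cos_le_of_arcs:
  fixes p h M :: nat and B :: "nat set"
  assumes p: "p + 1 = 2 * h" and B: "B \<subseteq> {0..<p}" and M: "M \<le> h"
    and arcs: "\<And>y. y < p \<Longrightarrow> 2 * card {b \<in> B. y < 2 * b \<and> 2 * b \<le> y + p} \<le> card B + M"
  shows "- (\<Sum>b\<in>B. cos (2 * pi * real b / real p)) \<le> (\<Sum>i<M. cos (pi * real i / real p))"
proof (cases "p = 0")
  case True
  then show ?thesis using p by presburger
next
  case False
  then have p0: "0 < p" by simp
  have finB: "finite B" using B finite_subset by auto
  \<comment> \<open>Sampling at half steps: \<open>cos (2 pi b / p)\<close> is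
    \<open>w (2 * b)\<close>, or \<open>- w (2 * b - p)\<close> once \<open>2 * b\<close> exceeds
    \<open>p\<close>, so only the decreasing half of the cosine is used.\<close>
  define w where "w = (\<lambda>x. cos (pi * real x / real p))"
  define v where "v = (\<lambda>y. w y - w (Suc y))"
  have wsym: "w (p - x) = - w x" if "x \<le> p" for x
  proof -
    have "pi * real (p - x) / real p = pi - pi * real x / real p"
      using p0 that by (simp add: of_nat_diff right_diff_distrib diff_divide_distrib)
    then show ?thesis unfolding w_def by (simp add: cos_diff)
  qed
  have w0: "w 0 = 1" and wp: "w p = - 1" unfolding w_def using p0 by auto
  have v0: "0 \<le> v y" if "y < p" for y
  proof -
    have "pi * real (Suc y) / real p \<le> pi" using that p0 by (simp add: divide_le_eq mult_left_mono)
    then have "w (Suc y) \<le> w y" unfolding w_def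
      by (intro cos_monotone_0_pi_le) (auto simp: divide_right_mono)
    then show ?thesis unfolding v_def by simp
  qed
  have vsym: "v (p - 1 - y) = v y" if "y < p" for y
  proof -
    have "p - 1 - y = p - Suc y" "Suc (p - Suc y) = p - y" using that by auto
    then show ?thesis unfolding v_def using wsym[of "Suc y"] wsym[of y] that by simp
  qed
  have tel: "(\<Sum>y\<in>{a..<b}. v y) = w a - w b" if "a \<le> b" for a b
    unfolding v_def using sum_Suc_diff'[of a b "\<lambda>x. - w x"] that by simp
  define inarc where "inarc = (\<lambda>b y. y < 2 * b \<and> 2 * b \<le> y + p)"
  define s where "s = (\<lambda>b y. if inarc b y then - 1 else (1::real))"
  \<comment> \<open>As \<open>w 0 + w p = 0\<close>, twice \<open>w x\<close> is the drop of
    \<open>w\<close> after \<open>x\<close> minus the drop before \<open>x\<close>.\<close>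
  have rep_pos: "2 * w x = (\<Sum>y<p. (if y < x then - 1 else 1) * v y)" if "x \<le> p" for x
  proof -
    have "{..<p} = {0..<x} \<union> {x..<p}" using that by auto
    then have "(\<Sum>y<p. (if y < x then - 1 else 1) * v y) =
       (\<Sum>y\<in>{0..<x}. (if y < x then - 1 else 1) * v y) + (\<Sum>y\<in>{x..<p}. (if y < x then - 1 else 1) * v y)"
      by (simp only:) (intro sum.union_disjoint, auto)
    also have "(\<Sum>y\<in>{0..<x}. (if y < x then - 1 else 1) * v y) = - (\<Sum>y\<in>{0..<x}. v y)"
      unfolding sum_negf[symmetric] by (intro sum.cong) auto
    also have "(\<Sum>y\<in>{x..<p}. (if y < x then - 1 else 1) * v y) = (\<Sum>y\<in>{x..<p}. v y)"
      by (intro sum.cong) auto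
    finally show ?thesis using tel[of 0 x] tel[of x p] that w0 wp by simp
  qed
  have rep: "2 * cos (2 * pi * real b / real p) = (\<Sum>y<p. s b y * v y)" if b: "b \<in> B" for b
  proof (cases "2 * b \<le> p")
    case True
    have "cos (2 * pi * real b / real p) = w (2 * b)" unfolding w_def by (simp add: algebra_simps)
    also have "2 * w (2 * b) = (\<Sum>y<p. (if y < 2 * b then - 1 else 1) * v y)" using rep_pos True by blast
    also have "\<dots> = (\<Sum>y<p. s b y * v y)"
      unfolding s_def inarc_def using True by (intro sum.cong) auto
    finally show ?thesis .
  next
    case False
    have bp: "b < p" using b B by auto
    have "2 * pi * real b / real p = pi * real (2 * b - p) / real p + pi"
      using False p0 by (simp add: of_nat_diff field_simps)
    then have "cos (2 * pi * real b / real p) = - w (2 * b - p)" unfolding w_def by simp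
    also have "2 * (- w (2 * b - p)) = - (\<Sum>y<p. (if y < 2 * b - p then - 1 else 1) * v y)"
      using rep_pos[of "2 * b - p"] bp by simp
    also have "\<dots> = (\<Sum>y<p. s b y * v y)"
      unfolding s_def inarc_def sum_negf[symmetric] using False bp by (intro sum.cong) auto
    finally show ?thesis .
  qed
  define \<tau> where "\<tau> = (\<lambda>y. - (\<Sum>b\<in>B. s b y))"
  have \<tau>_card: "\<tau> y = 2 * real (card {b \<in> B. inarc b y}) - real (card B)" for y
  proof -
    have "s b y = 1 - 2 * (if inarc b y then 1 else 0)" for b unfolding s_def by simp
    then have "(\<Sum>b\<in>B. s b y) = real (card B) - 2 * (\<Sum>b\<in>B. if inarc b y then 1 else 0)"
      by (simp add: sum_subtractf sum_distrib_left[symmetric])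
    also have "(\<Sum>b\<in>B. if inarc b y then 1 else 0::real) = real (card {b \<in> B. inarc b y})"
      using finB by (simp add: sum.inter_filter[symmetric])
    finally show ?thesis unfolding \<tau>_def by simp
  qed
  have \<tau>_M: "\<tau> y \<le> real M" if "y < p" for y
    using arcs[OF that] unfolding \<tau>_card inarc_def by linarith
  have \<tau>_pair: "\<tau> y + \<tau> (p - 1 - y) \<le> 2 * real (y + 1)" if y: "y < p" for y
  proof -
    let ?X = "{b \<in> B. inarc b y \<and> inarc b (p - 1 - y)}"
    have "- s b y - s b (p - 1 - y) \<le> 2 * (if inarc b y \<and> inarc b (p - 1 - y) then 1 else 0)" for b
      unfolding s_def by auto
    then have "(\<Sum>b\<in>B. - s b y - s b (p - 1 - y)) \<le> (\<Sum>b\<in>B. 2 * (if inarc b y \<and> inarc b (p - 1 - y) then 1 else 0))"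
      by (intro sum_mono)
    also have "\<dots> = 2 * real (card ?X)"
      unfolding sum_distrib_left[symmetric] using finB by (simp add: sum.inter_filter[symmetric])
    finally have "\<tau> y + \<tau> (p - 1 - y) \<le> 2 * real (card ?X)"
      unfolding \<tau>_def by (simp add: sum_subtractf sum_negf)
    \<comment> \<open>\<open>2 * b\<close> lies between \<open>p - y\<close> and
      \<open>p + y\<close>, and at most \<open>y + 1\<close> of these \<open>2 * y + 1\<close>
      integers are even.\<close>
    moreover have "card ?X \<le> y + 1"
    proof -
      define c where "c = (p - y + 1) div 2"
      have "?X \<subseteq> {c..<c + (y + 1)}"
      proof
        fix b assume "b \<in> ?X"
        then have "p - 1 - y < 2 * b" "2 * b \<le> y + p" unfolding inarc_def by auto
        then show "b \<in> {c..<c + (y + 1)}" unfolding c_def using y by auto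
      qed
      then have "card ?X \<le> card {c..<c + (y + 1)}" by (intro card_mono) auto
      then show ?thesis by simp
    qed
    then have "2 * real (card ?X) \<le> 2 * real (y + 1)" by simp
    ultimately show ?thesis by (rule order_trans)
  qed
  define \<mu> where "\<mu> = (\<lambda>y. real (min M (min (y + 1) (p - y))))"
  have pairM: "\<tau> y + \<tau> (p - 1 - y) \<le> 2 * \<mu> y" if y: "y < p" for y
  proof -
    have y': "p - 1 - y < p" "p - 1 - (p - 1 - y) = y" "p - 1 - y + 1 = p - y" using y by auto
    have "\<tau> y + \<tau> (p - 1 - y) \<le> 2 * real (p - y)" using \<tau>_pair[OF y'(1)] unfolding y' by simp
    then show ?thesis using \<tau>_pair[OF y] \<tau>_M[OF y] \<tau>_M[OF y'(1)] unfolding \<mu>_def by (auto simp: min_def)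
  qed
  have "- 2 * (\<Sum>b\<in>B. cos (2 * pi * real b / real p)) = - (\<Sum>b\<in>B. \<Sum>y<p. s b y * v y)"
    using rep by (simp add: sum_distrib_left sum_negf)
  also have "\<dots> = (\<Sum>y<p. \<tau> y * v y)"
    unfolding \<tau>_def by (subst sum.swap) (simp add: sum_negf sum_distrib_right)
  finally have e1: "- 2 * (\<Sum>b\<in>B. cos (2 * pi * real b / real p)) = (\<Sum>y<p. \<tau> y * v y)" .
  have "(\<Sum>y<p. \<tau> y * v y) = (\<Sum>y<p. \<tau> (p - 1 - y) * v y)"
  proof -
    have "(\<Sum>y<p. \<tau> y * v y) = (\<Sum>y<p. \<tau> (p - 1 - y) * v (p - 1 - y))"
      by (rule sum.reindex_bij_witness[of _ "\<lambda>y. p - 1 - y" "\<lambda>y. p - 1 - y"]) auto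
    also have "\<dots> = (\<Sum>y<p. \<tau> (p - 1 - y) * v y)" using vsym by (intro sum.cong) auto
    finally show ?thesis .
  qed
  then have "2 * (\<Sum>y<p. \<tau> y * v y) = (\<Sum>y<p. (\<tau> y + \<tau> (p - 1 - y)) * v y)"
    by (simp add: distrib_right sum.distrib)
  also have "\<dots> \<le> (\<Sum>y<p. (2 * \<mu> y) * v y)"
    using pairM v0 by (intro sum_mono mult_right_mono) auto
  also have "\<dots> = 2 * (\<Sum>y<p. \<mu> y * v y)" by (simp add: sum_distrib_left mult.assoc)
  finally have e2: "(\<Sum>y<p. \<tau> y * v y) \<le> (\<Sum>y<p. \<mu> y * v y)" by simp
  \<comment> \<open>The truncated tent \<open>\<mu>\<close> is a stack of \<open>M\<close>
    indicators of \<open>{i..<p - i}\<close>, over which \<open>v\<close> telescopes to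
    \<open>w i - w (p - i) = 2 * w i\<close>; \<open>M \<le> h\<close> ensures
    \<open>i \<le> p - i\<close>.\<close>
  have layer: "\<mu> y = (\<Sum>i<M. if i \<le> y \<and> y < p - i then 1 else 0)" if y: "y < p" for y
  proof -
    have "(\<Sum>i<M. if i \<le> y \<and> y < p - i then 1 else 0::real) = real (card {i \<in> {..<M}. i \<le> y \<and> y < p - i})"
      by (simp add: sum.inter_filter[symmetric])
    also have "{i \<in> {..<M}. i \<le> y \<and> y < p - i} = {..<min M (min (y + 1) (p - y))}" using y by auto
    finally show ?thesis unfolding \<mu>_def by simp
  qed
  have "(\<Sum>y<p. \<mu> y * v y) = (\<Sum>y<p. \<Sum>i<M. if i \<le> y \<and> y < p - i then v y else 0)"
    by (intro sum.cong refl) (simp add: layer sum_distrib_right if_distrib[of "\<lambda>z. z * _"] cong: if_cong)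
  also have "\<dots> = (\<Sum>i<M. \<Sum>y<p. if i \<le> y \<and> y < p - i then v y else 0)" by (rule sum.swap)
  also have "\<dots> = (\<Sum>i<M. 2 * w i)"
  proof (intro sum.cong refl)
    fix i assume "i \<in> {..<M}"
    then have i: "i \<le> p - i" "i \<le> p" using M p by auto
    have "(\<Sum>y<p. if i \<le> y \<and> y < p - i then v y else 0) = (\<Sum>y\<in>{y \<in> {..<p}. i \<le> y \<and> y < p - i}. v y)"
      by (rule sum.inter_filter[symmetric]) simp
    also have "{y \<in> {..<p}. i \<le> y \<and> y < p - i} = {i..<p - i}" by auto
    also have "(\<Sum>y\<in>{i..<p - i}. v y) = 2 * w i" using tel[OF i(1)] wsym[OF i(2)] by simp
    finally show "(\<Sum>y<p. if i \<le> y \<and> y < p - i then v y else 0) = 2 * w i" .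
  qed
  finally have "(\<Sum>y<p. \<mu> y * v y) = 2 * (\<Sum>i<M. w i)" by (simp add: sum_distrib_left)
  then show ?thesis using e1 e2 unfolding w_def by simp
qed

section \<open>Numerical estimates for the cosine sum\<close>

lemma pi_ge_3: "3 \<le> pi"
proof -
  have "sin (pi / 6) \<le> pi / 6" by (rule sin_x_le_x) simp
  then show ?thesis by (simp add: sin_30)
qed

lemma cos_le_quartic: "cos x \<le> 1 - x\<^sup>2 / 2 + x ^ 4 / 24" if "0 \<le> x" for x :: real
proof (cases "x = 0")
  case True then show ?thesis by simp
next
  case False
  then have "0 < x" using that by simp
  then obtain t where t: "cos x = (\<Sum>m<4. cos_coeff m * x ^ m) + (cos (t + 1/2 * real 4 * pi) / fact 4) * x ^ 4"
    using Maclaurin_cos_expansion2[of x 4] by auto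
  have "(\<Sum>m<4. cos_coeff m * x ^ m) = 1 - x\<^sup>2 / 2"
  proof -
    have "{..<4} = {0, 1, 2, 3::nat}" by auto
    then show ?thesis by (simp add: cos_coeff_def)
  qed
  moreover have "(cos (t + 1/2 * real 4 * pi) / fact 4) * x ^ 4 \<le> 1 / 24 * x ^ 4"
    by (intro mult_right_mono) (auto simp: fact_numeral divide_right_mono)
  ultimately show ?thesis using t by simp
qed

lemma cube_le_sum_squares: "1 \<le> M \<Longrightarrow> (real M - 1) ^ 3 \<le> 3 * (\<Sum>i<M. (real i)\<^sup>2)"
proof (induction M rule: nat_induct_at_least)
  case base then show ?case by simp
next
  case (Suc M)
  have "(real (Suc M) - 1) ^ 3 \<le> (real M - 1) ^ 3 + 3 * (real M)\<^sup>2"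
    using Suc.hyps by (simp add: power3_eq_cube power2_eq_square algebra_simps)
  then show ?case using Suc.IH by simp
qed

text \<open>With \<open>n = 0.313 p\<close> and \<open>k = (p - n)/3\<close> one has \<open>2k - n = 0.145 p\<close> and \<open>n^2/(p - n) > 0.1426 p\<close>.\<close>

lemma sum_cos_small:
  fixes p M :: nat
  assumes p: "14000 \<le> p" and M: "real M \<le> 145 / 1000 * real p + 4"
  shows "(\<Sum>i<M. cos (pi * real i / real p)) < 1426 / 10000 * real p"
\<comment> \<open>Bounding each cosine by 1 leaves only \<open>M\<close> between 0.1426 p and 0.1453
  p, where the quadratic term saves at least 0.0042 p.\<close>
proof (cases "real M < 1426 / 10000 * real p")
  case True
  have "(\<Sum>i<M. cos (pi * real i / real p)) \<le> (\<Sum>i<M. 1)" by (intro sum_mono) simp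
  then show ?thesis using True by simp
next
  case False
  define P where "P = real p"
  have P: "14000 \<le> P" unfolding P_def using p by simp
  have MP: "real M \<le> 1453 / 10000 * P" using M P unfolding P_def by linarith
  \<comment> \<open>For \<open>x = pi i / P\<close>, \<open>pi < 4\<close> gives
    \<open>x^2 \<le> 0.338\<close> and \<open>pi \<ge> 3\<close> gives
    \<open>x \<ge> 3 i / P\<close>; the constant is
    \<open>9 * (1/2 - 0.338/24) > 4.37\<close>.\<close>
  have each: "cos (pi * real i / P) \<le> 1 - 437 / 100 / P\<^sup>2 * (real i)\<^sup>2" if i: "i < M" for i
  proof -
    define x where "x = pi * real i / P"
    have x0: "0 \<le> x" unfolding x_def using P by simp
    have iP: "real i / P \<le> 1453 / 10000" using i MP P by (simp add: divide_le_eq)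
    have "x \<le> 4 * (1453 / 10000)"
      unfolding x_def using iP pi_less_4 P mult_mono[of pi 4 "real i / P" "1453/10000"] by simp
    then have "x\<^sup>2 \<le> (4 * (1453 / 10000))\<^sup>2" using x0 by (intro power_mono) auto
    then have x2: "x\<^sup>2 \<le> 338 / 1000" by (simp add: power2_eq_square)
    have "x ^ 4 = x\<^sup>2 * x\<^sup>2" by (simp add: power2_eq_square power4_eq_xxxx mult.assoc)
    also have "\<dots> \<le> 338 / 1000 * x\<^sup>2" using x2 by (intro mult_right_mono) auto
    finally have "cos x \<le> 1 - 11662 / 24000 * x\<^sup>2" using cos_le_quartic[OF x0] by (simp add: field_simps)
    moreover have "9 * (real i / P)\<^sup>2 \<le> x\<^sup>2"
    proof -
      have "3 * (real i / P) \<le> x" unfolding x_def using pi_ge_3 P mult_right_mono[of 3 pi "real i / P"] by simp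
      then have "(3 * (real i / P))\<^sup>2 \<le> x\<^sup>2" using P by (intro power_mono) auto
      then show ?thesis by (simp add: power2_eq_square)
    qed
    ultimately have "cos x \<le> 1 - 437 / 100 * (real i / P)\<^sup>2" using zero_le_power2[of "real i / P"] by linarith
    then show ?thesis unfolding x_def by (simp add: power_divide field_simps)
  qed
  have M1: "1 \<le> M" using False p by (cases M) auto
  have "1425 / 10000 * P \<le> real M - 1" using False P unfolding P_def by linarith
  then have "(1425 / 10000 * P) ^ 3 \<le> (real M - 1) ^ 3" using P by (intro power_mono) auto
  also have "\<dots> \<le> 3 * (\<Sum>i<M. (real i)\<^sup>2)" using M1 by (rule cube_le_sum_squares)
  finally have "(1425 / 10000) ^ 3 * P ^ 3 \<le> 3 * (\<Sum>i<M. (real i)\<^sup>2)" unfolding power_mult_distrib .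
  then have c: "(1425 / 10000) ^ 3 / 3 * P ^ 3 \<le> (\<Sum>i<M. (real i)\<^sup>2)" by (simp add: field_simps)
  have "437 / 100 / P\<^sup>2 * ((1425 / 10000) ^ 3 / 3 * P ^ 3) \<le> 437 / 100 / P\<^sup>2 * (\<Sum>i<M. (real i)\<^sup>2)"
    using c by (intro mult_left_mono) auto
  moreover have "437 / 100 / P\<^sup>2 * ((1425 / 10000) ^ 3 / 3 * P ^ 3) = 437 / 300 * (1425 / 10000) ^ 3 * P"
    using P by (simp add: power2_eq_square power3_eq_cube)
  moreover have "42 / 10000 * P \<le> 437 / 300 * (1425 / 10000) ^ 3 * P"
    using P by (intro mult_right_mono) (auto simp: power3_eq_cube)
  ultimately have low: "42 / 10000 * P \<le> 437 / 100 / P\<^sup>2 * (\<Sum>i<M. (real i)\<^sup>2)" by linarith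
  have "(\<Sum>i<M. cos (pi * real i / P)) \<le> (\<Sum>i<M. 1 - 437 / 100 / P\<^sup>2 * (real i)\<^sup>2)"
    using each by (intro sum_mono) auto
  also have "\<dots> = real M - 437 / 100 / P\<^sup>2 * (\<Sum>i<M. (real i)\<^sup>2)" by (simp add: sum_subtractf sum_distrib_left)
  also have "\<dots> < 1426 / 10000 * P" using low M P unfolding P_def by linarith
  finally show ?thesis unfolding P_def .
qed

text \<open>The worst case is \<open>N = 0.313 P\<close>, and it barely fits:
  \<open>0.1426 * 0.687 = 0.0979662\<close> against \<open>0.313^2 = 0.097969\<close>.\<close>

lemma quadratic_quotient_bound:
  fixes P N :: real
  assumes "0 \<le> P" "313 / 1000 * P \<le> N" "N < P"
  shows "1426 / 10000 * P \<le> N\<^sup>2 / (P - N)"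
proof -
  have "(313 / 1000 * P)\<^sup>2 \<le> N\<^sup>2" using assms by (intro power_mono) auto
  then have "(97969 / 1000000) * (P * P) \<le> N\<^sup>2" by (simp add: power2_eq_square)
  moreover have "1426 / 10000 * P * (P - N) \<le> 1426 / 10000 * P * (687 / 1000 * P)"
    using assms by (intro mult_left_mono) auto
  moreover have "1426 / 10000 * P * (687 / 1000 * P) \<le> (97969 / 1000000) * (P * P)" by (simp add: field_simps)
  ultimately have "1426 / 10000 * P * (P - N) \<le> N\<^sup>2" by linarith
  then show ?thesis using assms by (simp add: pos_le_divide_eq)
qed

lemma dense_arc_of_negative_cos_sum:
  assumes odd: "odd p" and p: "14000 \<le> p" and B: "B \<subseteq> {0..<p}" and dens: "313 / 1000 * real p \<le> real (card B)"
    and less: "card B < p"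
    and cos: "(\<Sum>b\<in>B. cos (2 * pi * real b / real p)) \<le> - (real (card B) ^ 2) / (real p - real (card B))"
  shows "\<exists>u::int. p + 7 \<le> card B + 3 * card {x \<in> B. (int x - u) mod int p < (int p + 1) div 2}"
proof (rule ccontr)
  assume neg: "\<not> ?thesis"
  obtain h where h: "p + 1 = 2 * h" using odd by (metis even_Suc evenE Suc_eq_plus1)
  then have hh: "(int p + 1) div 2 = int h" by presburger
  have finB: "finite B" using B finite_subset by auto
  define n where "n = card B"
  have lt: "n + 3 * card {x \<in> B. (int x - u) mod int p < int h} \<le> p + 6" for u
  proof -
    have "\<not> p + 7 \<le> n + 3 * card {x \<in> B. (int x - u) mod int p < int h}" using neg unfolding n_def hh by blast
    then show ?thesis by linarith
  qed
  \<comment> \<open>If a half circle holds at most \<open>(p + 6 - n)/3\<close> points, its excess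
    is at most \<open>2 (p + 6 - n)/3 - n\<close>. A negative value is cut to 0 by
    \<open>nat\<close>, which only weakens the bound.\<close>
  define M where "M = nat ((2 * int p + 12 - 5 * int n) div 3)"
  have dens': "313 / 1000 * real p \<le> real n" using dens n_def by simp
  have M: "real M \<le> 145 / 1000 * real p + 4"
  proof (cases "0 \<le> 2 * int p + 12 - 5 * int n")
    case True
    then have "int M = (2 * int p + 12 - 5 * int n) div 3" unfolding M_def by (simp add: pos_imp_zdiv_nonneg_iff)
    then have "3 * int M \<le> 2 * int p + 12 - 5 * int n" by presburger
    then have "3 * real M \<le> 2 * real p + 12 - 5 * real n" by linarith
    then show ?thesis using dens' by linarith
  next
    case False
    then have "M = 0" unfolding M_def by simp
    then show ?thesis by simp
  qed
  have Mh: "M \<le> h"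
  proof -
    have "real p + 1 = 2 * real h" using h by linarith
    then have "real M \<le> real h" using M p by linarith
    then show ?thesis by simp
  qed
  have arcs: "2 * card {b \<in> B. y < 2 * b \<and> 2 * b \<le> y + p} \<le> card B + M" if y: "y < p" for y
  proof -
    let ?u = "int (y div 2 + 1)"
    have "{b \<in> B. y < 2 * b \<and> 2 * b \<le> y + p} \<subseteq> {x \<in> B. (int x - ?u) mod int p < int h}"
    proof
      fix b assume "b \<in> {b \<in> B. y < 2 * b \<and> 2 * b \<le> y + p}"
      then have b: "b \<in> B" "y < 2 * b" "2 * b \<le> y + p" by auto
      have "0 \<le> int b - ?u" "int b - ?u < int h" "int h \<le> int p" using b h by presburger+
      then show "b \<in> {x \<in> B. (int x - ?u) mod int p < int h}" using b by simp
    qed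
    then have "card {b \<in> B. y < 2 * b \<and> 2 * b \<le> y + p} \<le> card {x \<in> B. (int x - ?u) mod int p < int h}"
      using finB by (intro card_mono) auto
    then have "n + 3 * card {b \<in> B. y < 2 * b \<and> 2 * b \<le> y + p} \<le> p + 6" using lt[of ?u] by linarith
    then show ?thesis unfolding n_def[symmetric] M_def by linarith
  qed
  have "- (\<Sum>b\<in>B. cos (2 * pi * real b / real p)) < 1426 / 10000 * real p"
    using sum_cos_le_of_arcs[OF h B Mh arcs] sum_cos_small[OF p M] by linarith
  moreover have "1426 / 10000 * real p \<le> real (card B) ^ 2 / (real p - real (card B))"
  proof -
    have "14000 \<le> real p" using p by simp
    then show ?thesis using less dens by (intro quadratic_quotient_bound) auto
  qed
  ultimately show False using cos by simp
qed

section \<open>Three successive confinements to shorter arcs\<close>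

theorem theorem3p4:
  fixes p :: nat and A :: "nat set"
  assumes "prime p" and "p \<ge> 14000"
    and "A \<subseteq> {0..<p}"
    and "sum_free_mod p A"
    and "real (card A) \<ge> (313 / 1000) * real p"
  shows "\<exists>m\<in>{1..p-1}. dilate_mod p m A \<subseteq> {card A .. p - card A}"
proof -
  note p = assms(1) and A = assms(3)
  have odd: "odd p" using p assms(2) prime_odd_nat[of p] by simp
  define n where "n = card A"
  define h where "h = (p + 1) div 2"
  have h: "2 * h = p + 1" unfolding h_def using odd by presburger
  have ih: "(int p + 1) div 2 = int h" using h by presburger
  have dens: "313 / 1000 * real p \<le> real n" using assms(5) unfolding n_def by simp
  have A0: "A \<noteq> {}" using assms(2) dens unfolding n_def by auto
  \<comment> \<open>Each pass dilates anew; recording dilates of \<open>A\<close> itself keeps size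
    and sum-freeness at hand and merges the multipliers into one.\<close>
  define Dil where "Dil = (\<lambda>B. \<exists>m\<in>{1..p-1}. B = dilate_mod p m A)"
  have Dil_facts: "B \<subseteq> {0..<p}" "sum_free_mod p B" "card B = n" if "Dil B" for B
  proof -
    obtain m where m: "m \<in> {1..p-1}" "B = dilate_mod p m A" using \<open>Dil B\<close> unfolding Dil_def by blast
    show "B \<subseteq> {0..<p}" "sum_free_mod p B" "card B = n"
      unfolding m(2) n_def using dilate_mod_facts(2,3)[OF p m(1) A] sum_free_dilate_mod[OF p m(1) A assms(4)] by blast+
  qed
  have step: "\<exists>C. Dil C \<and> C \<subseteq> {k..p - k}"
    if B: "Dil B" and k: "k = card {x \<in> B. (int x - u) mod int p < int h}" "p + 7 \<le> n + 3 * k" for B u k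
  proof -
    have "2 * int h \<le> int p + 1" using h by linarith
    then obtain m where m: "m \<in> {1..p-1}" "dilate_mod p m B \<subseteq> {k..p - k}"
      using sum_free_dense_arc[OF p Dil_facts(1,2)[OF B], of "int h" u] k Dil_facts(3)[OF B] by auto
    moreover have "Dil (dilate_mod p m B)"
      using B m(1) mult_mod_prime_nonzero[OF p m(1)] unfolding Dil_def by (auto simp: dilate_mod_dilate_mod)
    ultimately show ?thesis by blast
  qed
  obtain r where r: "r \<in> {1..p-1}" 
    "(\<Sum>a\<in>A. cos (2 * pi * real r * real a / real p)) \<le> - (real n ^ 2) / (real p - real n)"
    using sum_free_large_negative_coefficient[OF p A assms(4) A0] unfolding n_def by blast
  define B where "B = dilate_mod p r A"
  have B: "Dil B" unfolding Dil_def B_def using r(1) by blast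
  have "n < p" using card_sum_free_mod_less[OF _ A assms(4)] assms(2) unfolding n_def by simp
  then obtain u where "p + 7 \<le> n + 3 * card {x \<in> B. (int x - u) mod int p < int h}"
    using dense_arc_of_negative_cos_sum[OF odd assms(2) Dil_facts(1)[OF B]] Dil_facts(3)[OF B] dens
      cos_sum_dilate_mod[OF p r(1) A] r(2) unfolding B_def[symmetric] ih by auto
  then obtain k C where k: "p + 7 \<le> n + 3 * k" and C: "Dil C" "C \<subseteq> {k..p - k}" using step[OF B] by blast
  define k' where "k' = card {x \<in> C. (int x - int k) mod int p < int h}"
  have finC: "finite C" using Dil_facts(1)[OF C(1)] finite_subset by blast
  have arc: "(int x - int k) mod int p < int h" if "k \<le> x" "x < k + h" for x k
  proof -
    have "0 \<le> int x - int k" "int x - int k < int h" "int h \<le> int p" using that h assms(2) by linarith+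
    then show ?thesis by simp
  qed
  have "C \<subseteq> {x \<in> C. (int x - int k) mod int p < int h} \<union> {k + h..p - k}"
    using C(2) arc by force
  then have "card C \<le> card ({x \<in> C. (int x - int k) mod int p < int h} \<union> {k + h..p - k})"
    using finC by (intro card_mono) auto
  also have "\<dots> \<le> k' + card {k + h..p - k}" unfolding k'_def by (rule card_Un_le)
  finally have "n \<le> k' + (p - k + 1 - (k + h))" using Dil_facts(3)[OF C(1)] by simp
  then have nk: "real n \<le> real k' + max 0 (real p + 1 - 2 * real k - real h)" by (auto simp: max_def)
  have hr: "2 * real h = real p + 1" using h by linarith
  have kr: "real p + 7 \<le> real n + 3 * real k" using k by linarith
  \<comment> \<open>Either nothing of \<open>C\<close> lies beyond the half circle starting at
    \<open>k\<close>, and \<open>k' \<ge> n\<close>; or at most \<open>(p + 1)/2 - 2 * k\<close>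
    points do, which \<open>3 * k \<ge> p + 7 - n\<close> bounds by
    \<open>2 n / 3 - p / 6\<close>.\<close>
  have nk': "real n / 3 + real p / 6 + 2 \<le> real k'" using nk hr kr dens assms(2) by (auto simp: max_def split: if_splits)
  have "real p + 7 \<le> real n + 3 * real k'" using nk' dens assms(2) by linarith
  then have "p + 7 \<le> n + 3 * k'" by linarith
  then obtain E where E: "Dil E" "E \<subseteq> {k'..p - k'}" using step[OF C(1) k'_def] by blast
  \<comment> \<open>Now \<open>k'\<close> exceeds 0.27 p, so \<open>{k'..p - k'}\<close> fits into
    the half circle starting at \<open>k'\<close>, and the last pass counts all of
    \<open>E\<close>.\<close>
  have "real p + 2 \<le> real h + 2 * real k'" using nk' hr dens assms(2) by linarith
  then have "p < h + 2 * k'" by linarith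
  then have "{x \<in> E. (int x - int k') mod int p < int h} = E"
    using E(2) arc[of k'] by force
  then have "n = card {x \<in> E. (int x - int k') mod int p < int h}" using Dil_facts(3)[OF E(1)] by simp
  moreover have "p + 7 \<le> n + 3 * n" using dens assms(2) by linarith
  ultimately obtain F where "Dil F" "F \<subseteq> {n..p - n}" using step[OF E(1)] by blast
  then show ?thesis unfolding Dil_def n_def by blast
qed

end
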